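(* For every $a>1/2$ one has $\mathrm{ind}(\Sigma_a)\ge 4$. More precisely, the four functions $\Phi^0_a,\Phi^1_a,\Phi^2_a,\Phi^3_a$, given by the restrictions to $\Sigma_a$ of the Lorentz ambient coordinates $x_0,x_1,x_2,x_3$, are linearly independent in $H^1(\Sigma_a)$, and the quadratic form $\mathcal{S}$ is diagonal (with respect to $\Phi^0_a,\dots,\Phi^3_a$) and strictly negative on their span.
   Context: $\mathbb{H}^3=\{x\in\mathbb{R}^4:\langle x,x\rangle_L=-1,\ x_0>0\}$ with $\langle x,y\rangle_L=-x_0y_0+x_1y_1+x_2y_2+x_3y_3$. For $a>1/2$ put $A(s)=\sqrt{a\cosh(2s)+\tfrac12}$, $B(s)=\sqrt{a\cosh(2s)-\tfrac12}$, $K=K(a)=\sqrt{a^2-\tfrac14}$, and $\varphi(s)=\int_0^s\frac{K}{A(t)^2B(t)}\,dt$. Let $s_0=s_0(a)>0$ be the unique positive solution of $\tanh\varphi(s_0)=\frac{B(s_0)K}{a\sinh(2s_0)}$, and let $r(a)>0$ be defined by $\cosh r(a)=A(s_0)\cosh\varphi(s_0)$. The critical spherical catenoid is $$\Sigma_a=\Phi_a([-s_0,s_0]\times S^1),\quad \Phi_a(s,\theta)=\bigl(A\cosh\varphi,\,A\sinh\varphi,\,B\cos\theta,\,B\sin\theta\bigr)(s),$$ a free boundary minimal surface in the closed geodesic ball of radius $r(a)$ centered at $p_0=(1,0,0,0)$; its induced metric is $g=ds^2+B(s)^2d\theta^2$ and $|\mathrm{II}|^2=2K^2/B^4$. So $\Phi_a^0=A\cosh\varphi$,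 $\Phi^1_a=A\sinh\varphi$, $\Phi^2_a=B\cos\theta$, $\Phi^3_a=B\sin\theta$. The index form is $$\mathcal{S}(u,u)=\int_{\Sigma_a}\bigl(|\nabla u|_g^2-(|\mathrm{II}|^2-2)u^2\bigr)dA-\coth r(a)\int_{\partial\Sigma_a}u^2\,dL,$$ and $\mathrm{ind}(\Sigma_a)$ (Morse index) is the maximal dimension of a subspace of $H^1(\Sigma_a)$ on which $\mathcal{S}$ is negative definite. *)

theory Defs
  imports "HOL-Analysis.Analysis" "HOL-Library.Extended_Nat"
begin

section \<open>Spherical catenoids in hyperbolic space\<close>

text \<open>The index type of \<^typ>\<open>real^4\<close> has the elements 0, 1, 2, 3, so \<open>x $ 0\<close> is the
  time coordinate.\<close>

definition lorentz :: "real^4 \<Rightarrow> real^4 \<Rightarrow> real" where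
  "lorentz x y = - (x $ 0 * y $ 0) + x $ 1 * y $ 1 + x $ 2 * y $ 2 + x $ 3 * y $ 3"

definition hyperbolic3 :: "(real^4) set" where
  "hyperbolic3 = {x. lorentz x x = -1 \<and> x $ 0 > 0}"

definition catA :: "real \<Rightarrow> real \<Rightarrow> real" where
  "catA a s = sqrt (a * cosh (2 * s) + 1/2)"

definition catB :: "real \<Rightarrow> real \<Rightarrow> real" where
  "catB a s = sqrt (a * cosh (2 * s) - 1/2)"

definition catK :: "real \<Rightarrow> real" where
  "catK a = sqrt (a\<^sup>2 - 1/4)"

definition cat_phi :: "real \<Rightarrow> real \<Rightarrow> real" where
  "cat_phi a s = (LBINT t=0..s. catK a / ((catA a t)\<^sup>2 * catB a t))"

definition cat_s0 :: "real \<Rightarrow> real" where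
  "cat_s0 a = (THE s. s > 0 \<and> tanh (cat_phi a s) = catB a s * catK a / (a * sinh (2 * s)))"

definition cat_r :: "real \<Rightarrow> real" where
  "cat_r a = (THE r. r > 0 \<and> cosh r = catA a (cat_s0 a) * cosh (cat_phi a (cat_s0 a)))"

definition coth :: "real \<Rightarrow> real" where
  "coth x = cosh x / sinh x"

definition Phi :: "real \<Rightarrow> real \<times> real \<Rightarrow> real^4" where
  "Phi a = (\<lambda>(s, \<theta>). \<chi> i.
     if i = 0 then catA a s * cosh (cat_phi a s)
     else if i = 1 then catA a s * sinh (cat_phi a s)
     else if i = 2 then catB a s * cos \<theta>
     else catB a s * sin \<theta>)"

text \<open>The next two lemmas justify the metric \<open>ds\<^sup>2 + B(s)\<^sup>2 d\<theta>\<^sup>2\<close> used below.\<close>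

lemma cat_pos:
  assumes "a > 1/2"
  shows "catA a s > 0" "catB a s > 0" "catK a > 0"
    "(catA a s)\<^sup>2 = a * cosh (2 * s) + 1/2" "(catB a s)\<^sup>2 = a * cosh (2 * s) - 1/2"
    "(catK a)\<^sup>2 = a\<^sup>2 - 1/4"
proof -
  have "a * cosh (2 * s) \<ge> a * 1"
    using assms cosh_real_ge_1[of "2 * s"] by (intro mult_left_mono) auto
  then have c: "a * cosh (2 * s) > 1/2" using assms by linarith
  have "a * a > (1/2) * (1/2)" using assms by (intro mult_strict_mono) auto
  then have k: "a\<^sup>2 - 1/4 > 0" by (simp add: power2_eq_square)
  show "catA a s > 0" "catB a s > 0" "catK a > 0"
    "(catA a s)\<^sup>2 = a * cosh (2 * s) + 1/2" "(catB a s)\<^sup>2 = a * cosh (2 * s) - 1/2"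
    "(catK a)\<^sup>2 = a\<^sup>2 - 1/4"
    using c k by (simp_all add: catA_def catB_def catK_def)
qed

lemma cat_phi_deriv:
  assumes "a > 1/2"
  shows "(cat_phi a has_real_derivative catK a / ((catA a s)\<^sup>2 * catB a s)) (at s)"
proof -
  define f where "f = (\<lambda>t. catK a / ((catA a t)\<^sup>2 * catB a t))"
  define c d where "c = - \<bar>s\<bar> - 1" and "d = \<bar>s\<bar> + 1"
  have "continuous_on UNIV (catA a)" "continuous_on UNIV (catB a)"
    unfolding catA_def catB_def by (intro continuous_intros)+
  then have "continuous_on UNIV f"
    unfolding f_def using cat_pos(1,2)[OF assms]
    by (intro continuous_intros) (auto simp: less_imp_neq[symmetric])
  then have cf: "continuous_on {c..d} f" by (rule continuous_on_subset) auto
  have "((\<lambda>u. LBINT y=0..u. f y) has_vector_derivative f s) (at s within {c..d})"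
    using interval_integral_FTC2[of c 0 d f s] cf by (auto simp: c_def d_def zero_ereal_def)
  moreover have "at s within {c..d} = at s"
    by (rule at_within_interior) (auto simp: c_def d_def)
  ultimately show ?thesis
    by (simp add: cat_phi_def[abs_def] f_def has_real_derivative_iff_has_vector_derivative zero_ereal_def)
qed

lemma Phi_in_hyperbolic3:
  assumes "a > 1/2"
  shows "Phi a (s, \<theta>) \<in> hyperbolic3"
proof -
  let ?A = "catA a s" and ?B = "catB a s" and ?p = "cat_phi a s"
  note pos = cat_pos(1,2,4,5)[of a s, OF assms] cat_pos(3,6)[OF assms]
  have "lorentz (Phi a (s, \<theta>)) (Phi a (s, \<theta>)) =
      - ?A\<^sup>2 * ((cosh ?p)\<^sup>2 - (sinh ?p)\<^sup>2) + ?B\<^sup>2 * ((cos \<theta>)\<^sup>2 + (sin \<theta>)\<^sup>2)"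
    by (simp add: lorentz_def Phi_def power2_eq_square algebra_simps
      del: sin_cos_squared_add sin_cos_squared_add2 sin_cos_squared_add3)
  also have "\<dots> = -1"
    using pos(3,4) by (simp add: cosh_square_eq)
  finally show ?thesis
    using pos by (simp add: hyperbolic3_def Phi_def)
qed

lemma Phi_induced_metric:
  assumes "a > 1/2"
  shows "\<exists>X Y. ((\<lambda>s. Phi a (s, \<theta>)) has_vector_derivative X) (at s) \<and>
           ((\<lambda>\<theta>. Phi a (s, \<theta>)) has_vector_derivative Y) (at \<theta>) \<and>
           lorentz X X = 1 \<and> lorentz X Y = 0 \<and> lorentz Y Y = (catB a s)\<^sup>2"
proof -
  let ?A = "catA a s" and ?B = "catB a s" and ?p = "cat_phi a s"
  note pos = cat_pos(1,2,4,5)[of a s, OF assms] cat_pos(3,6)[OF assms]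
  define q where "q = catK a / (?A\<^sup>2 * ?B)"
  define A' where "A' = a * sinh (2 * s) / ?A"
  define B' where "B' = a * sinh (2 * s) / ?B"
  have A: "(catA a has_real_derivative A') (at s)"
    using pos unfolding catA_def A'_def
    by (auto intro!: derivative_eq_intros simp: field_simps)
  have B: "(catB a has_real_derivative B') (at s)"
    using pos unfolding catB_def B'_def
    by (auto intro!: derivative_eq_intros simp: field_simps)
  have p: "(cat_phi a has_real_derivative q) (at s)"
    using cat_phi_deriv[OF assms] by (simp add: q_def)
  have ch: "((\<lambda>s. cosh (cat_phi a s)) has_real_derivative sinh ?p * q) (at s)"
    and sh: "((\<lambda>s. sinh (cat_phi a s)) has_real_derivative cosh ?p * q) (at s)"
    by (auto intro!: derivative_eq_intros p)
  define X :: "real^4" where "X = (\<chi> i.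
     if i = 0 then A' * cosh ?p + ?A * (sinh ?p * q)
     else if i = 1 then A' * sinh ?p + ?A * (cosh ?p * q)
     else if i = 2 then B' * cos \<theta> else B' * sin \<theta>)"
  define Y :: "real^4" where "Y = (\<chi> i.
     if i = 0 then 0 else if i = 1 then 0
     else if i = 2 then - ?B * sin \<theta> else ?B * cos \<theta>)"
  have comp: "(f has_vector_derivative Z) (at t)"
    if "\<And>i. ((\<lambda>t. f t $ i) has_real_derivative Z $ i) (at t)" for f :: "real \<Rightarrow> real^4" and Z t
  proof -
    have "(f has_derivative (\<lambda>h. \<chi> i. h * Z $ i)) (at t)"
    proof (subst has_derivative_componentwise_within, intro ballI)
      fix b :: "real^4" assume "b \<in> Basis"
      then obtain i where b: "b = axis i 1" by (auto simp: Basis_vec_def)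
      show "((\<lambda>x. f x \<bullet> b) has_derivative (\<lambda>x. (\<chi> i. x * Z $ i) \<bullet> b)) (at t)"
        using that[of i] by (simp add: b inner_axis has_field_derivative_def mult_commute_abs)
    qed
    moreover have "(\<lambda>h. \<chi> i. h * Z $ i) = (\<lambda>h. h *\<^sub>R Z)" by (auto simp: vec_eq_iff)
    ultimately show ?thesis by (simp add: has_vector_derivative_def)
  qed
  have dX: "((\<lambda>s. Phi a (s, \<theta>)) has_vector_derivative X) (at s)"
  proof (rule comp)
    fix i :: 4
    show "((\<lambda>t. Phi a (t, \<theta>) $ i) has_real_derivative X $ i) (at s)"
      using DERIV_mult[OF A ch] DERIV_mult[OF A sh] DERIV_cmult_right[OF B, of "cos \<theta>"]
        DERIV_cmult_right[OF B, of "sin \<theta>"]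
      by (simp add: Phi_def X_def algebra_simps)
  qed
  have dY: "((\<lambda>\<theta>. Phi a (s, \<theta>)) has_vector_derivative Y) (at \<theta>)"
  proof (rule comp)
    fix i :: 4
    show "((\<lambda>t. Phi a (s, t) $ i) has_real_derivative Y $ i) (at \<theta>)"
      by (auto simp: Phi_def Y_def intro!: derivative_eq_intros)
  qed
  have "lorentz X X = - (A'\<^sup>2 - ?A\<^sup>2 * q\<^sup>2) * ((cosh ?p)\<^sup>2 - (sinh ?p)\<^sup>2)
      + B'\<^sup>2 * ((cos \<theta>)\<^sup>2 + (sin \<theta>)\<^sup>2)"
    by (simp add: lorentz_def X_def power2_eq_square algebra_simps
      del: sin_cos_squared_add sin_cos_squared_add2 sin_cos_squared_add3)
  also have "\<dots> = ?A\<^sup>2 * q\<^sup>2 - A'\<^sup>2 + B'\<^sup>2" by (simp add: cosh_square_eq)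
  also have "\<dots> = (catK a)\<^sup>2 / (?A\<^sup>2 * ?B\<^sup>2) - (a * sinh (2 * s))\<^sup>2 / ?A\<^sup>2 + (a * sinh (2 * s))\<^sup>2 / ?B\<^sup>2"
    using pos(1,2) by (simp add: q_def A'_def B'_def power_divide power_mult_distrib power2_eq_square)
  also have "\<dots> = ((catK a)\<^sup>2 + (a * sinh (2 * s))\<^sup>2 * (?A\<^sup>2 - ?B\<^sup>2)) / (?A\<^sup>2 * ?B\<^sup>2)"
    using pos(1,2) by (simp add: field_simps)
  also have "(catK a)\<^sup>2 + (a * sinh (2 * s))\<^sup>2 * (?A\<^sup>2 - ?B\<^sup>2) = ?A\<^sup>2 * ?B\<^sup>2"
    unfolding pos(3,4,6) power_mult_distrib sinh_square_eq by (simp add: power2_eq_square algebra_simps)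
  finally have "lorentz X X = 1" using pos(1,2) by simp
  moreover have "lorentz X Y = 0" by (simp add: lorentz_def X_def Y_def)
  moreover have "lorentz Y Y = ?B\<^sup>2 * ((sin \<theta>)\<^sup>2 + (cos \<theta>)\<^sup>2)"
    by (simp add: lorentz_def Y_def power2_eq_square algebra_simps
      del: sin_cos_squared_add sin_cos_squared_add2 sin_cos_squared_add3)
  ultimately show ?thesis using dX dY by auto
qed

definition cat_II_sq :: "real \<Rightarrow> real \<Rightarrow> real" where
  "cat_II_sq a s = 2 * (catK a)\<^sup>2 / (catB a s) ^ 4"

section \<open>Function spaces on the critical catenoid\<close>

text \<open>A function on the critical catenoid is represented by some \<open>u :: real^4 \<Rightarrow> real\<close>, of which
  only the restriction to the surface matters; it is studied through its pullback
  \<open>\<lambda>p. u (Phi a p)\<close>, which is \<open>2\<pi>\<close>-periodic in \<open>\<theta>\<close>.  Integrals are taken over one period, and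
  \<open>area a\<close> is the Riemannian area measure \<open>B(s) ds d\<theta>\<close> there.\<close>

definition catenoid :: "real \<Rightarrow> (real^4) set" where
  "catenoid a = Phi a ` ({- cat_s0 a..cat_s0 a} \<times> UNIV)"

definition cell :: "real \<Rightarrow> (real \<times> real) set" where
  "cell a = {- cat_s0 a..cat_s0 a} \<times> {0..2 * pi}"

lemma Phi_image_cell: "Phi a ` cell a = catenoid a"
proof -
  have "Phi a (s, \<theta>) \<in> Phi a ` cell a" if "s \<in> {- cat_s0 a..cat_s0 a}" for s \<theta>
  proof -
    obtain t where t: "0 \<le> t" "t < 2 * pi" "cos \<theta> = cos t" "sin \<theta> = sin t"
      using sincos_total_2pi[of "cos \<theta>" "sin \<theta>"] by (metis sin_cos_squared_add2)
    then have "Phi a (s, \<theta>) = Phi a (s, t)" unfolding Phi_def prod.case by (simp only: t(3,4))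
    moreover have "(s, t) \<in> cell a" using that t by (auto simp: cell_def)
    ultimately show ?thesis by (metis imageI)
  qed
  then show ?thesis by (auto simp: catenoid_def cell_def)
qed

definition area :: "real \<Rightarrow> (real \<times> real) measure" where
  "area a = density (restrict_space lborel (cell a)) (\<lambda>p. ennreal (catB a (fst p)))"

text \<open>Integral over the two boundary circles \<open>s = \<plusminus>s\<^sub>0\<close> with line element \<open>dL = B(\<plusminus>s\<^sub>0) d\<theta>\<close>.\<close>

definition bdry_integral :: "real \<Rightarrow> (real \<times> real \<Rightarrow> real) \<Rightarrow> real" where
  "bdry_integral a F =
     (\<Sum>\<sigma>\<in>{- cat_s0 a, cat_s0 a}. LINT \<theta>:{0..2 * pi}|lborel. F (\<sigma>, \<theta>) * catB a \<sigma>)"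

definition L2 :: "real \<Rightarrow> (real \<times> real \<Rightarrow> real) \<Rightarrow> bool" where
  "L2 a U \<longleftrightarrow> U \<in> borel_measurable (area a) \<and> integrable (area a) (\<lambda>p. (U p)\<^sup>2)"

definition L2_bdry :: "real \<Rightarrow> (real \<times> real \<Rightarrow> real) \<Rightarrow> bool" where
  "L2_bdry a T \<longleftrightarrow> (\<forall>\<sigma>\<in>{- cat_s0 a, cat_s0 a}.
     set_borel_measurable lborel {0..2 * pi} (\<lambda>\<theta>. T (\<sigma>, \<theta>)) \<and>
     set_integrable lborel {0..2 * pi} (\<lambda>\<theta>. (T (\<sigma>, \<theta>))\<^sup>2))"

text \<open>\<open>f\<close> is a continuously differentiable function of \<open>(s, \<theta>)\<close> on \<open>\<real> \<times> S\<^sup>1\<close> with partial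
  derivatives \<open>fs\<close> and \<open>ft\<close>.\<close>

definition C1_cyl ::
  "(real \<times> real \<Rightarrow> real) \<Rightarrow> (real \<times> real \<Rightarrow> real) \<Rightarrow> (real \<times> real \<Rightarrow> real) \<Rightarrow> bool" where
  "C1_cyl f fs ft \<longleftrightarrow>
     (\<forall>s \<theta>. f (s, \<theta> + 2 * pi) = f (s, \<theta>)) \<and>
     (\<forall>p. (f has_derivative (\<lambda>h. fst h * fs p + snd h * ft p)) (at p)) \<and>
     continuous_on UNIV fs \<and> continuous_on UNIV ft"

text \<open>\<open>V\<close> and \<open>W\<close> are the weak derivatives of \<open>U\<close> in the directions \<open>s\<close> and \<open>\<theta>\<close> on the open
  cylinder.  Test functions are \<open>C\<^sup>1\<close>, compactly supported in \<open>s\<close>, and periodic in \<open>\<theta>\<close>.\<close>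

definition weak_derivs ::
  "real \<Rightarrow> (real \<times> real \<Rightarrow> real) \<Rightarrow> (real \<times> real \<Rightarrow> real) \<Rightarrow> (real \<times> real \<Rightarrow> real) \<Rightarrow> bool" where
  "weak_derivs a U V W \<longleftrightarrow> L2 a V \<and> L2 a W \<and>
     (\<forall>\<psi> \<psi>s \<psi>t. C1_cyl \<psi> \<psi>s \<psi>t \<and>
        (\<exists>\<delta>>0. \<forall>s \<theta>. \<bar>s\<bar> > cat_s0 a - \<delta> \<longrightarrow> \<psi> (s, \<theta>) = 0) \<longrightarrow>
        (LINT p:cell a|lborel. U p * \<psi>s p) = - (LINT p:cell a|lborel. V p * \<psi> p) \<and>
        (LINT p:cell a|lborel. U p * \<psi>t p) = - (LINT p:cell a|lborel. W p * \<psi> p))"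

definition H1 :: "real \<Rightarrow> (real^4 \<Rightarrow> real) set" where
  "H1 a = {u. L2 a (u \<circ> Phi a) \<and> (\<exists>V W. weak_derivs a (u \<circ> Phi a) V W)}"

text \<open>The weak derivatives are determined up to null sets only; any choice will do.\<close>

definition wderiv :: "real \<Rightarrow> (real^4 \<Rightarrow> real) \<Rightarrow> (real \<times> real \<Rightarrow> real) \<times> (real \<times> real \<Rightarrow> real)" where
  "wderiv a u = (SOME (V, W). weak_derivs a (u \<circ> Phi a) V W)"

definition wderiv_s :: "real \<Rightarrow> (real^4 \<Rightarrow> real) \<Rightarrow> real \<times> real \<Rightarrow> real" where
  "wderiv_s a u = fst (wderiv a u)"

definition wderiv_t :: "real \<Rightarrow> (real^4 \<Rightarrow> real) \<Rightarrow> real \<times> real \<Rightarrow> real" where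
  "wderiv_t a u = snd (wderiv a u)"

text \<open>The trace operator \<open>H\<^sup>1 \<rightarrow> L\<^sup>2(\<partial>\<Sigma>)\<close> is the continuous extension of \<open>f \<mapsto> f|\<partial>\<Sigma>\<close> from
  \<open>C\<^sup>1\<close> functions on the closed surface: \<open>T\<close> is the trace of \<open>u\<close> if some \<open>C\<^sup>1\<close> functions
  converge to \<open>u\<close> in \<open>H\<^sup>1\<close> while their boundary values converge to \<open>T\<close> in \<open>L\<^sup>2\<close>.\<close>

definition is_trace :: "real \<Rightarrow> (real^4 \<Rightarrow> real) \<Rightarrow> (real \<times> real \<Rightarrow> real) \<Rightarrow> bool" where
  "is_trace a u T \<longleftrightarrow> L2_bdry a T \<and>
     (\<exists>f fs ft. (\<forall>n. C1_cyl (f n) (fs n) (ft n)) \<and>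
        (\<lambda>n::nat. LINT p|area a. (f n p - u (Phi a p))\<^sup>2 + (fs n p - wderiv_s a u p)\<^sup>2
            + (ft n p - wderiv_t a u p)\<^sup>2 / (catB a (fst p))\<^sup>2) \<longlonglongrightarrow> 0 \<and>
        (\<lambda>n. bdry_integral a (\<lambda>p. (f n p - T p)\<^sup>2)) \<longlonglongrightarrow> 0)"

definition bdry_trace :: "real \<Rightarrow> (real^4 \<Rightarrow> real) \<Rightarrow> real \<times> real \<Rightarrow> real" where
  "bdry_trace a u = (SOME T. is_trace a u T)"

section \<open>Index form and Morse index\<close>

text \<open>The symmetric bilinear form belonging to the quadratic form \<open>u \<mapsto> index_form a u u\<close>.\<close>

definition index_form :: "real \<Rightarrow> (real^4 \<Rightarrow> real) \<Rightarrow> (real^4 \<Rightarrow> real) \<Rightarrow> real" where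
  "index_form a u v =
     (LINT p|area a.
        (wderiv_s a u p * wderiv_s a v p + wderiv_t a u p * wderiv_t a v p / (catB a (fst p))\<^sup>2)
        - (cat_II_sq a (fst p) - 2) * (u (Phi a p) * v (Phi a p)))
     - coth (cat_r a) * bdry_integral a (\<lambda>p. bdry_trace a u p * bdry_trace a v p)"

text \<open>Equality to the zero element of \<open>H\<^sup>1\<close>, whose elements are classes modulo null sets.\<close>

definition ae_zero :: "real \<Rightarrow> (real^4 \<Rightarrow> real) \<Rightarrow> bool" where
  "ae_zero a u \<longleftrightarrow> (AE p in area a. u (Phi a p) = 0)"

definition lin_indep_H1 :: "real \<Rightarrow> 'i set \<Rightarrow> ('i \<Rightarrow> real^4 \<Rightarrow> real) \<Rightarrow> bool" where
  "lin_indep_H1 a I f \<longleftrightarrow> (\<forall>i\<in>I. f i \<in> H1 a) \<and>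
     (\<forall>c. ae_zero a (\<lambda>x. \<Sum>i\<in>I. c i * f i x) \<longrightarrow> (\<forall>i\<in>I. c i = 0))"

text \<open>Negative definiteness of the index form on the span of a finite family.\<close>

definition neg_def_on_span :: "real \<Rightarrow> 'i set \<Rightarrow> ('i \<Rightarrow> real^4 \<Rightarrow> real) \<Rightarrow> bool" where
  "neg_def_on_span a I f \<longleftrightarrow>
     (\<forall>c. let u = (\<lambda>x. \<Sum>i\<in>I. c i * f i x) in \<not> ae_zero a u \<longrightarrow> index_form a u u < 0)"

definition ambient_coord :: "4 \<Rightarrow> real^4 \<Rightarrow> real" where
  "ambient_coord i x = x $ i"

text \<open>An \<open>n\<close>-dimensional subspace of \<open>H\<^sup>1\<close> is given by a basis \<open>f 0, \<dots>, f (n - 1)\<close>.\<close>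

definition morse_index :: "real \<Rightarrow> enat" where
  "morse_index a = Sup {enat n | n.
     \<exists>f :: nat \<Rightarrow> real^4 \<Rightarrow> real. lin_indep_H1 a {..<n} f \<and> neg_def_on_span a {..<n} f}"

end

theory Submission
  imports Defs
begin

text \<open>
  The ambient coordinates restrict to a minimal surface in \<open>H\<^sup>3\<close> as solutions of \<open>\<Delta> v = 2 v\<close>, and
  the free boundary condition makes the conormal at a boundary point \<open>x\<close> equal to
  \<open>coth r * x - p\<^sub>0 / sinh r\<close>.  Hence \<open>\<Phi>\<^sup>1, \<Phi>\<^sup>2, \<Phi>\<^sup>3\<close> satisfy the Robin condition of the index form
  exactly, while \<open>\<Phi>\<^sup>0\<close> fails it by the constant \<open>- 1 / sinh r\<close>.  For \<open>u = \<Sum>i. c\<^sub>i \<Phi>\<^sup>i\<close> and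
  \<open>v = \<Sum>i. d\<^sub>i \<Phi>\<^sup>i\<close>, Green's formula cancels the gradient term, the term \<open>2 u v\<close> and most of the
  boundary term.  What remains is \<open>S(u, v) = - \<integral> |II|\<^sup>2 u v dA - \<kappa> c\<^sub>0 d\<^sub>0\<close> with some \<open>\<kappa> > 0\<close>,
  because the integral of \<open>u\<close> over the boundary only sees \<open>c\<^sub>0\<close>
  (lemma \<open>index_form_ambient_comb\<close>).  On the diagonal this is negative as soon as \<open>u\<close> is not zero
  almost everywhere, since \<open>|II|\<^sup>2 > 0\<close>.  For two different coordinates \<open>c\<^sub>0 d\<^sub>0 = 0\<close>, and the
  integral vanishes by orthogonality in \<open>\<theta>\<close> or by parity in \<open>s\<close>.

  The two geometric inputs are computations with the profile functions.  The equation
  \<open>\<Delta> v = 2 v\<close> is \<open>axial_flux_deriv\<close>, which rests on \<open>(a sinh 2s)\<^sup>2 + K\<^sup>2 = A\<^sup>2 B\<^sup>2\<close>; the boundary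
  condition is \<open>axial_robin\<close>, which rests on the equation defining \<open>s\<^sub>0\<close>.

  The index form is defined through a choice of weak derivatives and of a trace, so these have to
  be identified before Green's formula can be used.  Weak derivatives are unique almost everywhere
  by the fundamental lemma of the calculus of variations (\<open>cylinder_fundamental_lemma\<close>), and traces
  are unique by an inequality bounding boundary values by the \<open>H\<^sup>1\<close> norm (\<open>trace_inequality\<close>).
  Functions with a continuously differentiable pullback therefore have their classical derivatives
  and boundary values, and \<open>index_form_C1\<close> gives the classical form of \<open>S\<close>.
\<close>

section \<open>The profile curve and its free boundary\<close>

context
  fixes a :: real
  assumes a: "a > 1/2"
begin

lemma catA_deriv: "(catA a has_real_derivative a * sinh (2 * s) / catA a s) (at s)"
  using cat_pos(1,4)[OF a, of s] unfolding catA_def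
  by (auto intro!: derivative_eq_intros simp: field_simps)

lemma catB_deriv: "(catB a has_real_derivative a * sinh (2 * s) / catB a s) (at s)"
  using cat_pos(2,5)[OF a, of s] unfolding catB_def
  by (auto intro!: derivative_eq_intros simp: field_simps)

lemma continuous_on_cat:
  "continuous_on X (catA a)" "continuous_on X (catB a)" "continuous_on X (cat_phi a)"
  using catA_deriv catB_deriv cat_phi_deriv[OF a]
  by (meson DERIV_isCont continuous_at_imp_continuous_on)+

lemma catA_minus: "catA a (- s) = catA a s" and catB_minus: "catB a (- s) = catB a s"
  by (simp_all add: catA_def catB_def)

lemma cat_phi_0: "cat_phi a 0 = 0"
  by (simp add: cat_phi_def zero_ereal_def)

lemma cat_phi_minus: "cat_phi a (- s) = - cat_phi a s"
proof -
  have "((\<lambda>s. cat_phi a s + cat_phi a (- s)) has_real_derivative 0) (at s)" for s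
  proof -
    have "((\<lambda>s. cat_phi a (- s)) has_real_derivative
        catK a / ((catA a (- s))\<^sup>2 * catB a (- s)) * - 1) (at s)"
      by (rule DERIV_chain2[OF cat_phi_deriv[OF a]]) (auto intro!: derivative_eq_intros)
    from DERIV_add[OF cat_phi_deriv[OF a, of s] this] show ?thesis
      by (simp add: catA_minus catB_minus)
  qed
  then have "cat_phi a s + cat_phi a (- s) = cat_phi a 0 + cat_phi a (- 0)"
    using DERIV_isconst_all[of "\<lambda>s. cat_phi a s + cat_phi a (- s)" s 0] by blast
  then show ?thesis by (simp add: cat_phi_0)
qed

lemma cat_phi_strict_mono:
  assumes "x < y"
  shows "cat_phi a x < cat_phi a y"
proof (rule DERIV_pos_imp_increasing[OF assms])
  show "\<exists>z. (cat_phi a has_real_derivative z) (at s) \<and> 0 < z" for s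
    using cat_phi_deriv[OF a, of s] cat_pos(1,2)[OF a, of s] cat_pos(3)[OF a]
    by (intro exI[of _ "catK a / ((catA a s)\<^sup>2 * catB a s)"] conjI) auto
qed

lemma catA_sq_eq: "(catA a s)\<^sup>2 = (catB a s)\<^sup>2 + 1"
  using cat_pos(4,5)[OF a, of s] by simp

lemma profile_identity: "(a * sinh (2 * s))\<^sup>2 + (catK a)\<^sup>2 = (catA a s)\<^sup>2 * (catB a s)\<^sup>2"
  unfolding cat_pos(4,5,6)[OF a] power_mult_distrib sinh_square_eq
  by (simp add: power2_eq_square algebra_simps)

text \<open>The right-hand side of the equation for \<open>s\<^sub>0\<close> decreases, because its square is
  \<open>K\<^sup>2/a\<^sup>2\<close> times \<open>(a c - 1/2) / (c\<^sup>2 - 1)\<close> with \<open>c = cosh (2 s)\<close>; the difference of two values of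
  that quotient has the sign of \<open>a c d - (c + d)/2 + a\<close>, which exceeds
  \<open>(c - 1) (d - 1) / 2 \<ge> 0\<close>.\<close>

lemma free_boundary_rhs_strict_antimono:
  assumes "0 < x" "x < y"
  shows "catB a y * catK a / (a * sinh (2 * y)) < catB a x * catK a / (a * sinh (2 * x))"
proof -
  let ?c = "cosh (2 * x)" and ?d = "cosh (2 * y)"
  have sx: "0 < sinh (2 * x)" and sy: "0 < sinh (2 * y)" using assms by simp_all
  have c: "1 < ?c" "?c < ?d" using assms cosh_real_strict_mono[of 0 "2 * x"] cosh_real_strict_mono[of "2 * x" "2 * y"] by auto
  have "0 \<le> (?c - 1) * (?d - 1)" using c by simp
  moreover have "(a - 1/2) * (?c * ?d + 1) > 0" using a c by (intro mult_pos_pos) (auto simp: add_pos_pos)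
  ultimately have "0 < a * ?c * ?d - (?c + ?d)/2 + a" by (simp add: algebra_simps)
  then have "0 < (?d - ?c) * (a * ?c * ?d - (?c + ?d)/2 + a)" using c by simp
  also have "\<dots> = (a * ?c - 1/2) * (?d\<^sup>2 - 1) - (a * ?d - 1/2) * (?c\<^sup>2 - 1)"
    by (simp add: power2_eq_square field_simps)
  finally have "(a * ?d - 1/2) * (sinh (2 * x))\<^sup>2 < (a * ?c - 1/2) * (sinh (2 * y))\<^sup>2"
    by (simp add: sinh_square_eq)
  then have "(catB a y * sinh (2 * x))\<^sup>2 < (catB a x * sinh (2 * y))\<^sup>2"
    by (simp add: power_mult_distrib cat_pos(5)[OF a])
  then have "catB a y * sinh (2 * x) < catB a x * sinh (2 * y)"
    by (rule power_less_imp_less_base) (use cat_pos(2)[OF a] sy in \<open>simp add: less_imp_le\<close>)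
  then have "catB a y / sinh (2 * y) < catB a x / sinh (2 * x)"
    using sx sy by (simp add: field_simps)
  then have "catB a y / sinh (2 * y) * (catK a / a) < catB a x / sinh (2 * x) * (catK a / a)"
    by (rule mult_strict_right_mono) (use a cat_pos(3)[OF a] in simp)
  then show ?thesis by (simp add: mult.commute)
qed

text \<open>The difference of the two sides, multiplied by \<open>a sinh (2 s)\<close>, is negative at \<open>0\<close>.  For large
  \<open>s\<close> it is positive: \<open>tanh \<phi>\<close> stays above \<open>tanh (\<phi> 1)\<close>, and \<open>sinh (2 s)\<close> outgrows \<open>B\<close>, whose
  square is only of order \<open>sinh (2 s)\<close>.\<close>

lemma free_boundary_parameter_exists:
  "\<exists>s>0. tanh (cat_phi a s) = catB a s * catK a / (a * sinh (2 * s))"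
proof -
  define g where "g = (\<lambda>s. tanh (cat_phi a s) * (a * sinh (2 * s)) - catB a s * catK a)"
  have cont: "continuous_on X g" for X
    unfolding g_def by (intro continuous_intros continuous_on_cat) (simp_all add: cosh_real_nonzero)
  have g0: "g 0 < 0" using cat_pos[OF a] by (simp add: g_def cat_phi_0)
  define m where "m = tanh (cat_phi a 1)"
  have m: "m > 0" using cat_phi_strict_mono[of 0 1] by (simp add: m_def cat_phi_0)
  have K: "catK a > 0" by (rule cat_pos(3)[OF a])
  (* y is the value of sinh (2 s): the first argument gives s >= 1, the second makes
     (m a y)^2 exceed the bound 2 a y K^2 for (B K)^2 *)
  define y where "y = max (sinh 2) (2 * (catK a)\<^sup>2 / (m\<^sup>2 * a) + 1)"
  have y: "y \<ge> sinh 2" "y \<ge> 1" "m\<^sup>2 * a * y > 2 * (catK a)\<^sup>2"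
  proof -
    have p: "m\<^sup>2 * a > 0" using m a by simp
    show "y \<ge> sinh 2" by (simp add: y_def)
    show "y \<ge> 1" using p by (simp add: y_def le_max_iff_disj)
    have "2 * (catK a)\<^sup>2 / (m\<^sup>2 * a) < y" unfolding y_def by linarith
    then show "m\<^sup>2 * a * y > 2 * (catK a)\<^sup>2" using p by (simp add: pos_divide_less_eq mult.commute)
  qed
  define s where "s = arsinh y / 2"
  have sinh_s: "sinh (2 * s) = y" by (simp add: s_def)
  have "sinh 2 \<le> sinh (2 * s)" using y(1) by (simp add: sinh_s)
  then have s: "1 \<le> s" by simp
  have "(cosh (2 * s))\<^sup>2 \<le> (y + 1)\<^sup>2"
    unfolding cosh_square_eq sinh_s using y(2) by (simp add: power2_eq_square algebra_simps)
  then have cosh_s: "cosh (2 * s) \<le> y + 1"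
    by (rule power2_le_imp_le) (use y(2) in simp)
  have "(catB a s * catK a)\<^sup>2 \<le> a * (y + 1) * (catK a)\<^sup>2"
    unfolding power_mult_distrib cat_pos(5)[OF a]
  proof (rule mult_right_mono)
    show "a * cosh (2 * s) - 1/2 \<le> a * (y + 1)"
      using mult_left_mono[OF cosh_s, of a] a by linarith
  qed simp
  also have "\<dots> \<le> a * (2 * y) * (catK a)\<^sup>2"
    using y(2) a by (intro mult_right_mono mult_left_mono) auto
  also have "\<dots> = (a * y) * (2 * (catK a)\<^sup>2)" by simp
  also have "\<dots> < (a * y) * (m\<^sup>2 * a * y)"
    using y a by (intro mult_strict_left_mono) auto
  also have "\<dots> = (m * (a * y))\<^sup>2" by (simp add: power2_eq_square)
  finally have "catB a s * catK a < m * (a * y)"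
    by (rule power_less_imp_less_base) (use m a y in simp)
  also have "m * (a * y) \<le> tanh (cat_phi a s) * (a * y)"
    using s cat_phi_strict_mono[of 1 s] a y unfolding m_def
    by (intro mult_right_mono) (auto simp: le_less)
  finally have gs: "g s > 0" by (simp add: g_def sinh_s)
  from IVT'[of g 0 0 s] g0 gs s cont obtain x where x: "0 \<le> x" "g x = 0" by auto
  with g0 have "x > 0" by (cases "x = 0") auto
  with x(2) a show ?thesis
    by (intro exI[of _ x]) (auto simp: g_def field_simps)
qed

lemma cat_s0_props:
  "cat_s0 a > 0"
  "tanh (cat_phi a (cat_s0 a)) = catB a (cat_s0 a) * catK a / (a * sinh (2 * cat_s0 a))"
proof -
  let ?P = "\<lambda>s. s > 0 \<and> tanh (cat_phi a s) = catB a s * catK a / (a * sinh (2 * s))"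
  have uniq: False if "?P x" "?P y" "x < y" for x y
  proof -
    have "tanh (cat_phi a x) < tanh (cat_phi a y)" using cat_phi_strict_mono that(3) by simp
    with that free_boundary_rhs_strict_antimono[of x y] show False by linarith
  qed
  have "\<exists>!s. ?P s"
    using free_boundary_parameter_exists uniq by (metis linorder_neqE_linordered_idom)
  from theI'[OF this] show "cat_s0 a > 0"
    "tanh (cat_phi a (cat_s0 a)) = catB a (cat_s0 a) * catK a / (a * sinh (2 * cat_s0 a))"
    unfolding cat_s0_def by blast+
qed

lemma cat_r_props:
  "cat_r a > 0"
  "cosh (cat_r a) = catA a (cat_s0 a) * cosh (cat_phi a (cat_s0 a))"
proof -
  let ?c = "catA a (cat_s0 a) * cosh (cat_phi a (cat_s0 a))"
  have "1\<^sup>2 < (catA a (cat_s0 a))\<^sup>2" using cat_pos(2)[OF a, of "cat_s0 a"] by (simp add: catA_sq_eq)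
  then have "1 < catA a (cat_s0 a)"
    by (rule power_less_imp_less_base) (use cat_pos(1)[OF a] in \<open>simp add: less_imp_le\<close>)
  then have c: "?c > 1"
    using cosh_real_ge_1 by (rule less_1_mult')
  have "\<exists>!r. r > 0 \<and> cosh r = ?c"
  proof (rule ex_ex1I)
    show "\<exists>r. r > 0 \<and> cosh r = ?c"
      using c by (intro exI[of _ "arcosh ?c"]) simp
    show "r = r'" if "r > 0 \<and> cosh r = ?c" "r' > 0 \<and> cosh r' = ?c" for r r'
      using that by (metis abs_of_pos cosh_real_abs arcosh_cosh_real less_imp_le)
  qed
  from theI'[OF this] show "cat_r a > 0" "cosh (cat_r a) = ?c"
    unfolding cat_r_def by blast+
qed

text \<open>The free boundary condition says that the conormal of the boundary is radial; for the last
  two coordinates this is \<open>B'/B = coth r\<close> at \<open>s\<^sub>0\<close>.  Writing \<open>S = sinh (2 s\<^sub>0)\<close>, the equation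
  for \<open>s\<^sub>0\<close> turns \<open>A\<^sup>2 cosh\<^sup>2 \<phi>\<close> into \<open>(a S)\<^sup>2 / (B\<^sup>2 - K\<^sup>2)\<close>, so that
  \<open>sinh\<^sup>2 r = B\<^sup>4 / (B\<^sup>2 - K\<^sup>2)\<close>.\<close>

lemma coth_cat_r: "coth (cat_r a) = a * sinh (2 * cat_s0 a) / (catB a (cat_s0 a))\<^sup>2"
proof -
  define s A B K p S where "s = cat_s0 a" and "A = catA a s" and "B = catB a s"
    and "K = catK a" and "p = cat_phi a s" and "S = a * sinh (2 * s)"
  have pos: "A > 0" "B > 0" "K > 0" "s > 0" "S > 0"
    using cat_pos[OF a] cat_s0_props(1) a by (auto simp: A_def B_def K_def s_def S_def)
  have AB: "A\<^sup>2 = B\<^sup>2 + 1" and id: "S\<^sup>2 + K\<^sup>2 = A\<^sup>2 * B\<^sup>2"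
    using catA_sq_eq profile_identity by (simp_all add: A_def B_def K_def S_def)
  have t: "sinh p * S = cosh p * (B * K)"
    using cat_s0_props(2) pos unfolding tanh_def
    by (simp flip: s_def A_def B_def K_def p_def S_def) (simp add: field_simps)
  have ch: "(cosh p)\<^sup>2 = (sinh p)\<^sup>2 + 1" by (simp add: cosh_square_eq)
  have "(cosh p)\<^sup>2 * (B * K)\<^sup>2 = (sinh p)\<^sup>2 * S\<^sup>2"
    by (simp only: power_mult_distrib[symmetric] t)
  also have "\<dots> = (cosh p)\<^sup>2 * S\<^sup>2 - S\<^sup>2" by (simp add: ch algebra_simps)
  finally have e: "(cosh p)\<^sup>2 * (S\<^sup>2 - (B * K)\<^sup>2) = S\<^sup>2" by (simp add: algebra_simps)
  have f: "S\<^sup>2 - (B * K)\<^sup>2 = A\<^sup>2 * (B\<^sup>2 - K\<^sup>2)"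
    using id by (simp add: AB power_mult_distrib algebra_simps)
  have c: "cosh (cat_r a) = A * cosh p"
    using cat_r_props(2) by (simp add: A_def p_def s_def)
  have g: "(cosh (cat_r a))\<^sup>2 * (B\<^sup>2 - K\<^sup>2) = S\<^sup>2"
    using e unfolding f c by (simp add: power_mult_distrib algebra_simps)
  have "(cosh (cat_r a))\<^sup>2 * B^4 = S\<^sup>2 * (sinh (cat_r a))\<^sup>2"
  proof -
    have "(sinh (cat_r a))\<^sup>2 * (B\<^sup>2 - K\<^sup>2) = S\<^sup>2 - (B\<^sup>2 - K\<^sup>2)"
      using g by (simp add: sinh_square_eq algebra_simps)
    also have "\<dots> = A\<^sup>2 * B\<^sup>2 - B\<^sup>2" using id by simp
    also have "\<dots> = B^4" unfolding AB by (simp add: power2_eq_square power4_eq_xxxx algebra_simps)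
    finally show ?thesis using g by (metis mult.assoc mult.commute)
  qed
  then have "(cosh (cat_r a) * B\<^sup>2)\<^sup>2 = (S * sinh (cat_r a))\<^sup>2"
    by (simp add: power_mult_distrib)
  then have "cosh (cat_r a) * B\<^sup>2 = S * sinh (cat_r a)"
    by (rule power2_eq_imp_eq) (use pos cat_r_props(1) in auto)
  then show ?thesis
    using pos cat_r_props(1)
    unfolding coth_def s_def[symmetric] B_def[symmetric] S_def[symmetric]
    by (simp add: field_simps)
qed

end

text \<open>The part \<open>c 0 * \<Phi>\<^sup>0 + c 1 * \<Phi>\<^sup>1\<close> of a combination of the coordinates, which is invariant under
  rotation, and its derivative.\<close>

definition axial :: "real \<Rightarrow> (4 \<Rightarrow> real) \<Rightarrow> real \<Rightarrow> real" where
  "axial a c s = catA a s * (c 0 * cosh (cat_phi a s) + c 1 * sinh (cat_phi a s))"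

definition axial_s :: "real \<Rightarrow> (4 \<Rightarrow> real) \<Rightarrow> real \<Rightarrow> real" where
  "axial_s a c s =
     a * sinh (2 * s) / catA a s * (c 0 * cosh (cat_phi a s) + c 1 * sinh (cat_phi a s))
     + catK a / (catA a s * catB a s) * (c 0 * sinh (cat_phi a s) + c 1 * cosh (cat_phi a s))"

context
  fixes a :: real
  assumes a: "a > 1/2"
begin

lemma axial_deriv: "(axial a c has_real_derivative axial_s a c s) (at s)"
proof -
  note d = catA_deriv[OF a, of s] cat_phi_deriv[OF a, of s]
  have "catA a s \<noteq> 0" "catB a s \<noteq> 0" using cat_pos(1,2)[OF a, of s] by auto
  then show ?thesis
    unfolding axial_def[abs_def] axial_s_def
    by (auto intro!: derivative_eq_intros d simp: field_simps power2_eq_square)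
qed

text \<open>The equation \<open>\<Delta> v = 2 v\<close> for rotationally invariant \<open>v\<close>, where \<open>\<Delta> v = (B v')' / B\<close>.  Let
  \<open>v = A h\<close>, and let \<open>k\<close> be \<open>h\<close> with \<open>cosh\<close> and \<open>sinh\<close> interchanged, so that \<open>h' = k \<phi>'\<close> and
  \<open>k' = h \<phi>'\<close>.  The terms in \<open>k\<close> cancel because \<open>\<phi>' = K / (A\<^sup>2 B)\<close>, and those in \<open>h\<close> collapse by
  \<open>(a sinh 2s)\<^sup>2 + K\<^sup>2 = A\<^sup>2 B\<^sup>2\<close>.\<close>

lemma axial_flux_deriv:
  "((\<lambda>s. catB a s * axial_s a c s) has_real_derivative 2 * catB a s * axial a c s) (at s)"
proof -
  define A B K p S C where defs: "A = catA a s" "B = catB a s" "K = catK a" "p = cat_phi a s"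
    "S = a * sinh (2 * s)" "C = a * cosh (2 * s)"
  have nz: "A \<noteq> 0" "B \<noteq> 0" using cat_pos(1,2)[OF a, of s] by (auto simp: defs)
  have rel: "B\<^sup>2 = A\<^sup>2 - 1" "C = A\<^sup>2 - 1/2" "K\<^sup>2 = A\<^sup>2 * (A\<^sup>2 - 1) - S\<^sup>2"
    using catA_sq_eq[OF a, of s] cat_pos(4)[OF a, of s] profile_identity[OF a, of s] by (simp_all add: defs)
  define h where "h = (\<lambda>s. c 0 * cosh (cat_phi a s) + c 1 * sinh (cat_phi a s))"
  define k where "k = (\<lambda>s. c 0 * sinh (cat_phi a s) + c 1 * cosh (cat_phi a s))"
  define q where "q = K / (A\<^sup>2 * B)"
  have dp: "(cat_phi a has_real_derivative q) (at s)"
    using cat_phi_deriv[OF a] by (simp add: q_def defs)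
  have dh: "(h has_real_derivative k s * q) (at s)"
    unfolding h_def k_def by (auto intro!: derivative_eq_intros dp simp: algebra_simps)
  have dk: "(k has_real_derivative h s * q) (at s)"
    unfolding h_def k_def by (auto intro!: derivative_eq_intros dp simp: algebra_simps)
  have dA: "(catA a has_real_derivative S / A) (at s)" and dB: "(catB a has_real_derivative S / B) (at s)"
    using catA_deriv[OF a] catB_deriv[OF a] by (simp_all add: defs)
  have dS: "((\<lambda>s. a * sinh (2 * s)) has_real_derivative 2 * C) (at s)"
    unfolding defs by (auto intro!: derivative_eq_intros)
  have eq: "(\<lambda>s. catB a s * axial_s a c s) =
      (\<lambda>s. (a * sinh (2 * s)) * catB a s / catA a s * h s + K / catA a s * k s)"
    using cat_pos(1,2)[OF a] by (auto simp: axial_s_def h_def k_def defs field_simps less_imp_neq[symmetric])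
  have 1: "((\<lambda>s. (a * sinh (2 * s)) * catB a s / catA a s * h s + K / catA a s * k s) has_real_derivative
     ((2 * C * B + S * (S / B)) * A - S * B * (S / A)) / (A * A) * h s + S * B / A * (k s * q)
     + (- (K * (S / A)) / (A * A) * k s + K / A * (h s * q))) (at s)"
    by (rule DERIV_cong, rule DERIV_add[OF DERIV_mult[OF DERIV_divide[OF DERIV_mult[OF dS dB] dA] dh]
          DERIV_mult[OF DERIV_divide[OF DERIV_const dA] dk]])
      (unfold defs(1-5)[symmetric], use nz in \<open>simp_all add: mult_ac\<close>)
  have "((2 * C * B + S * (S / B)) * A - S * B * (S / A)) / (A * A) + K / A * q =
      (2 * C * B\<^sup>2 * A\<^sup>2 + S\<^sup>2 * (A\<^sup>2 - B\<^sup>2) + K\<^sup>2) / (A^3 * B)"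
    using nz by (simp add: q_def field_simps power2_eq_square power3_eq_cube)
  also have "2 * C * B\<^sup>2 * A\<^sup>2 + S\<^sup>2 * (A\<^sup>2 - B\<^sup>2) + K\<^sup>2 = 2 * A\<^sup>2 * A\<^sup>2 * B\<^sup>2"
    unfolding rel by (simp add: algebra_simps)
  also have "2 * A\<^sup>2 * A\<^sup>2 * B\<^sup>2 / (A^3 * B) = 2 * A * B"
    using nz by (simp add: field_simps power2_eq_square power3_eq_cube)
  finally have H: "((2 * C * B + S * (S / B)) * A - S * B * (S / A)) / (A * A) + K / A * q = 2 * A * B" .
  have "((2 * C * B + S * (S / B)) * A - S * B * (S / A)) / (A * A) * h s + S * B / A * (k s * q)
     + (- (K * (S / A)) / (A * A) * k s + K / A * (h s * q)) =
     (((2 * C * B + S * (S / B)) * A - S * B * (S / A)) / (A * A) + K / A * q) * h s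
     + (S * B / A * q - K * (S / A) / (A * A)) * k s"
    by (simp add: algebra_simps)
  also have "S * B / A * q - K * (S / A) / (A * A) = 0"
    using nz by (simp add: q_def field_simps power2_eq_square)
  finally have "((2 * C * B + S * (S / B)) * A - S * B * (S / A)) / (A * A) * h s + S * B / A * (k s * q)
     + (- (K * (S / A)) / (A * A) * k s + K / A * (h s * q)) = 2 * B * (A * h s)"
    unfolding H by simp
  with 1 show ?thesis unfolding eq by (simp add: axial_def h_def defs)
qed

lemma axial_minus: "axial a c (- s) = axial a (c(1 := - c 1)) s"
  and axial_s_minus: "axial_s a c (- s) = - axial_s a (c(1 := - c 1)) s"
  by (simp_all add: axial_def axial_s_def catA_minus[OF a] catB_minus[OF a] cat_phi_minus[OF a] algebra_simps)

text \<open>The conormal at a boundary point \<open>x\<close> is \<open>coth r * x - p\<^sub>0 / sinh r\<close>, so only the time coordinate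
  fails the Robin condition; \<open>\<kappa>\<close> is \<open>1 / sinh r\<close>.  The lower boundary circle follows from the upper
  one by the reflection \<open>s \<mapsto> - s\<close>, which changes the sign of \<open>c 1\<close>.\<close>

lemma axial_robin:
  "\<exists>\<kappa>>0. \<forall>c. axial_s a c (cat_s0 a) = coth (cat_r a) * axial a c (cat_s0 a) - \<kappa> * c 0 \<and>
     - axial_s a c (- cat_s0 a) = coth (cat_r a) * axial a c (- cat_s0 a) - \<kappa> * c 0"
proof -
  define s A B K p S where defs: "s = cat_s0 a" "A = catA a s" "B = catB a s"
    "K = catK a" "p = cat_phi a s" "S = a * sinh (2 * s)"
  have pos: "A > 0" "B > 0" "K > 0" "s > 0" "S > 0"
    using cat_pos[OF a] cat_s0_props(1)[OF a] a by (auto simp: defs)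
  have AB: "A\<^sup>2 = B\<^sup>2 + 1" using catA_sq_eq[OF a] by (simp add: defs)
  have t: "tanh p = B * K / S" using cat_s0_props(2)[OF a] by (simp add: defs)
  then have sh: "sinh p = cosh p * (B * K / S)"
    using pos by (simp add: tanh_def field_simps)
  have "B * K / S < 1" using tanh_real_lt_1[of p] t by simp
  then have BK: "B * K < S" using pos by simp
  define \<kappa> where "\<kappa> = cosh p * (S\<^sup>2 - (B * K)\<^sup>2) / (A * B\<^sup>2 * S)"
  have "(B * K)\<^sup>2 < S\<^sup>2" using BK pos by (intro power_strict_mono) auto
  then have \<kappa>: "\<kappa> > 0" using pos by (simp add: \<kappa>_def)
  have *: "axial_s a c s = coth (cat_r a) * axial a c s - \<kappa> * c 0" for c
  proof -
    have co: "coth (cat_r a) = S / B\<^sup>2" using coth_cat_r[OF a] by (simp add: defs)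
    have "axial_s a c s - coth (cat_r a) * axial a c s =
        S / A * (c 0 * cosh p + c 1 * sinh p) + K / (A * B) * (c 0 * sinh p + c 1 * cosh p)
        - S / B\<^sup>2 * (A * (c 0 * cosh p + c 1 * sinh p))"
      unfolding axial_s_def axial_def co by (simp add: defs)
    also have "\<dots> = (S / A - S * A / B\<^sup>2) * (c 0 * cosh p + c 1 * sinh p)
        + K / (A * B) * (c 0 * sinh p + c 1 * cosh p)" by (simp add: algebra_simps)
    also have "S / A - S * A / B\<^sup>2 = S * (B\<^sup>2 - A\<^sup>2) / (A * B\<^sup>2)"
      using pos by (simp add: field_simps power2_eq_square)
    also have "\<dots> = - S / (A * B\<^sup>2)" by (simp add: AB)
    also have "- S / (A * B\<^sup>2) * (c 0 * cosh p + c 1 * sinh p)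
        + K / (A * B) * (c 0 * sinh p + c 1 * cosh p) = - \<kappa> * c 0"
      unfolding sh \<kappa>_def using pos by (simp add: field_simps power2_eq_square)
    finally show ?thesis by simp
  qed
  show ?thesis
    using \<kappa> *[unfolded defs(1)] by (intro exI[of _ \<kappa>]) (simp add: axial_minus axial_s_minus)
qed

end

section \<open>Integration over a rectangle\<close>

text \<open>The sets with vanishing integral form a Dynkin system, and boxes are a generator of the Borel
  sets that is closed under intersection.\<close>

lemma AE_zero_if_box_integrals_zero:
  fixes h :: "'a::euclidean_space \<Rightarrow> real"
  assumes int: "set_integrable lborel (box L U) h"
    and zero: "\<And>l u. box l u \<subseteq> box L U \<Longrightarrow> (LINT x:box l u|lborel. h x) = 0"
  shows "AE x in lborel. x \<in> box L U \<longrightarrow> h x = 0"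
proof -
  define H where "H = (\<lambda>x. indicator (box L U) x * h x)"
  have iH: "integrable lborel H"
    using int by (simp add: set_integrable_def H_def)
  have iHA: "set_integrable lborel A H" if "A \<in> sets lborel" for A
    using integrable_mult_indicator[OF that iH] by (simp add: set_integrable_def)
  have box0: "(LINT x:box l u|lborel. H x) = 0" for l u
  proof -
    obtain l' u' where lu: "box L U \<inter> box l u = box l' u'"
      using box_Int_box by blast
    have "(LINT x:box l u|lborel. H x) = (LINT x:box l' u'|lborel. h x)"
      unfolding set_lebesgue_integral_def lu[symmetric] H_def
      by (intro Bochner_Integration.integral_cong) (auto simp: indicator_def)
    also have "\<dots> = 0" by (rule zero) (use lu in auto)
    finally show ?thesis .
  qed
  have total: "(LINT x|lborel. H x) = 0"
  proof -
    have "(LINT x|lborel. H x) = (LINT x:box L U|lborel. H x)"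
      unfolding set_lebesgue_integral_def H_def
      by (intro Bochner_Integration.integral_cong) (auto simp: indicator_def)
    then show ?thesis using box0 by simp
  qed
  let ?G = "range (\<lambda>(l, u). box l u :: 'a set)"
  have sig: "sigma_sets UNIV ?G = sets borel"
    by (subst borel_eq_box) (rule sets_measure_of[symmetric], simp)
  have all: "(LINT x:A|lborel. H x) = 0" if "A \<in> sets borel" for A
  proof -
    have "Int_stable ?G"
      by (auto simp: Int_stable_def box_Int_box)
    moreover have "?G \<subseteq> Pow UNIV" "A \<in> sigma_sets UNIV ?G"
      using that by (simp_all add: sig)
    ultimately show ?thesis
    proof (induction rule: sigma_sets_induct_disjoint)
      case (basic A) then show ?case using box0 by auto
    next
      case empty show ?case by (simp add: set_lebesgue_integral_def)
    next
      case (compl A)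
      then have A: "A \<in> sets borel" by (simp add: sig)
      have "(LINT x:UNIV|lborel. H x) = (LINT x:A|lborel. H x) + (LINT x:UNIV - A|lborel. H x)"
        using set_integral_Un[of A "UNIV - A" lborel H] iHA A by (simp add: Un_absorb1)
      then show ?case using compl.IH total by (simp add: set_lebesgue_integral_def)
    next
      case (union A)
      then have A: "A i \<in> sets borel" for i using sig by auto
      have "(LINT x:(\<Union>i. A i)|lborel. H x) = (\<Sum>i. (LINT x:A i|lborel. H x))"
        using union(1) A by (intro lebesgue_integral_countable_add iHA)
          (auto simp: disjoint_family_on_def)
      then show ?case using union.IH by simp
    qed
  qed
  have "AE x in lborel. H x = 0"
  proof (rule density_unique_real[OF iH])
    show "(LINT x:A|lborel. H x) = (LINT x:A|lborel. 0)" if "A \<in> sets lborel" for A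
      using all[of A] that by (simp add: set_lebesgue_integral_def)
  qed simp
  then show ?thesis by eventually_elim (auto simp: H_def)
qed

lemma AE_cbox_interior:
  fixes L U :: "'a::euclidean_space"
  shows "AE x in lborel. x \<in> cbox L U \<longrightarrow> x \<in> box L U"
proof (rule AE_I')
  have "cbox L U - box L U \<in> null_sets lebesgue"
    using negligible_frontier_interval by (simp add: negligible_iff_null_sets)
  then show "cbox L U - box L U \<in> null_sets lborel"
    by (subst (asm) null_sets_completion_iff) auto
qed auto

lemma rectangle_eq_cbox:
  fixes a b c d :: real
  shows "{a..b} \<times> {c..d} = cbox (a, c) (b, d)" and "{a<..<b} \<times> {c<..<d} = box (a, c) (b, d)"
  by (auto simp: cbox_Pair_eq box_prod)

lemma set_integrable_rectangle:
  fixes F :: "real \<times> real \<Rightarrow> real"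
  assumes "continuous_on ({a..b} \<times> {c..d}) F"
  shows "set_integrable lborel ({a..b} \<times> {c..d}) F"
  unfolding set_integrable_def using assms
  by (intro borel_integrable_compact) (auto intro: compact_Times)

lemma rectangle_integral:
  fixes F :: "real \<times> real \<Rightarrow> real"
  assumes "continuous_on ({a..b} \<times> {c..d}) F"
  shows "(LINT p:{a..b} \<times> {c..d}|lborel. F p) = (LINT x:{a..b}|lborel. LINT y:{c..d}|lborel. F (x, y))"
    and "(LINT p:{a..b} \<times> {c..d}|lborel. F p) = (LINT y:{c..d}|lborel. LINT x:{a..b}|lborel. F (x, y))"
proof -
  have i: "integrable (lborel \<Otimes>\<^sub>M lborel)
      (\<lambda>(x, y). indicator {a..b} x * (indicator {c..d} y * F (x, y)))"
    using set_integrable_rectangle[OF assms] unfolding set_integrable_def lborel_prod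
    by (rule back_subst[of "integrable lborel"]) (auto simp: indicator_times)
  have eq: "(LINT p:{a..b} \<times> {c..d}|lborel. F p) = integral\<^sup>L (lborel \<Otimes>\<^sub>M lborel)
      (\<lambda>(x, y). indicator {a..b} x * (indicator {c..d} y * F (x, y)))"
    unfolding set_lebesgue_integral_def lborel_prod
    by (rule Bochner_Integration.integral_cong) (auto simp: indicator_times)
  show "(LINT p:{a..b} \<times> {c..d}|lborel. F p) = (LINT x:{a..b}|lborel. LINT y:{c..d}|lborel. F (x, y))"
    unfolding eq lborel_pair.integral_fst[OF i, symmetric] by (simp add: set_lebesgue_integral_def)
  have "(LINT y|lborel. LINT x|lborel. indicator {a..b} x * (indicator {c..d} y * F (x, y)))
      = (LINT y|lborel. LINT x|lborel. indicator {c..d} y * (indicator {a..b} x * F (x, y)))"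
    by (simp add: mult.left_commute)
  then show "(LINT p:{a..b} \<times> {c..d}|lborel. F p) = (LINT y:{c..d}|lborel. LINT x:{a..b}|lborel. F (x, y))"
    unfolding eq lborel_pair.integral_snd[OF i, symmetric] by (simp add: set_lebesgue_integral_def)
qed

lemma interval_FTC:
  fixes f f' :: "real \<Rightarrow> real"
  assumes "a \<le> b" "\<And>x. (f has_real_derivative f' x) (at x)" "continuous_on {a..b} f'"
  shows "(LINT x:{a..b}|lborel. f' x) = f b - f a"
  unfolding set_lebesgue_integral_def
  using assms by (intro integral_FTC_atLeastAtMost)
    (auto simp: has_real_derivative_iff_has_vector_derivative intro: has_vector_derivative_at_within)

lemma rectangle_integral_deriv_fst:
  fixes F F' :: "real \<times> real \<Rightarrow> real"
  assumes "a \<le> b" "\<And>x y. ((\<lambda>x. F (x, y)) has_real_derivative F' (x, y)) (at x)"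
    and c: "continuous_on UNIV F'"
  shows "(LINT p:{a..b} \<times> {c..d}|lborel. F' p) = (LINT y:{c..d}|lborel. F (b, y) - F (a, y))"
proof -
  have "(LINT x:{a..b}|lborel. F' (x, y)) = F (b, y) - F (a, y)" for y
  proof (rule interval_FTC[where f = "\<lambda>x. F (x, y)", OF assms(1,2)])
    show "continuous_on {a..b} (\<lambda>x. F' (x, y))"
      by (rule continuous_on_compose2[OF c]) (auto intro!: continuous_intros)
  qed
  then show ?thesis
    using rectangle_integral(2)[of a b c d F'] continuous_on_subset[OF c] by simp
qed

lemma rectangle_integral_deriv_snd:
  fixes F F' :: "real \<times> real \<Rightarrow> real"
  assumes "c \<le> d" "\<And>x y. ((\<lambda>y. F (x, y)) has_real_derivative F' (x, y)) (at y)"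
    and c: "continuous_on UNIV F'"
  shows "(LINT p:{a..b} \<times> {c..d}|lborel. F' p) = (LINT x:{a..b}|lborel. F (x, d) - F (x, c))"
proof -
  have "(LINT y:{c..d}|lborel. F' (x, y)) = F (x, d) - F (x, c)" for x
  proof (rule interval_FTC[where f = "\<lambda>y. F (x, y)", OF assms(1,2)])
    show "continuous_on {c..d} (\<lambda>y. F' (x, y))"
      by (rule continuous_on_compose2[OF c]) (auto intro!: continuous_intros)
  qed
  then show ?thesis
    using rectangle_integral(1)[of a b c d F'] continuous_on_subset[OF c] by simp
qed

section \<open>The fundamental lemma of the calculus of variations on the cylinder\<close>

text \<open>The functions \<open>n m\<^sup>2 / (1 + n m\<^sup>2)\<close> with \<open>m = max 0 (y - 1/n)\<close> are continuously differentiable,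
  because \<open>max 0\<close> is squared.  The shift by \<open>1/n\<close> keeps the support away from \<open>y = 0\<close>.\<close>

lemma C1_step_approximation:
  obtains \<tau> \<tau>' :: "nat \<Rightarrow> real \<Rightarrow> real" where
    "\<And>n y. (\<tau> n has_real_derivative \<tau>' n y) (at y)" "\<And>n. continuous_on UNIV (\<tau>' n)"
    "\<And>n y. 0 \<le> \<tau> n y" "\<And>n y. \<tau> n y \<le> 1" "\<And>n y. y \<le> 1 / real (Suc n) \<Longrightarrow> \<tau> n y = 0"
    "\<And>y. (\<lambda>n. \<tau> n y) \<longlonglongrightarrow> (if y > 0 then 1 else 0)"
proof -
  define m where "m = (\<lambda>n y. max 0 (y - 1 / real (Suc n)))"
  define D where "D = (\<lambda>n y. 1 + real (Suc n) * (m n y)\<^sup>2)"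
  define \<tau> where "\<tau> = (\<lambda>n y. 1 - 1 / D n y)"
  define \<tau>' where "\<tau>' = (\<lambda>n y. real (Suc n) * (2 * m n y) / (D n y)\<^sup>2)"
  have D: "D n y \<ge> 1" for n y by (simp add: D_def)
  have Dnz: "D n y \<noteq> 0" for n y using D[of n y] by simp
  have sq: "((\<lambda>y::real. (max 0 y)\<^sup>2) has_real_derivative 2 * max 0 y) (at y)" for y :: real
  proof (cases "y = 0")
    case True
    have "((\<lambda>h::real. (max 0 h)\<^sup>2 / h) \<longlongrightarrow> 0) (at 0)"
    proof (rule Lim_null_comparison)
      show "\<forall>\<^sub>F h in at 0. norm ((max 0 h)\<^sup>2 / h) \<le> \<bar>h::real\<bar>"
        by (auto simp: eventually_at_filter power2_eq_square max_def)
      show "((\<lambda>h::real. \<bar>h\<bar>) \<longlongrightarrow> 0) (at 0)" by (auto intro!: tendsto_eq_intros)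
    qed
    then show ?thesis using True by (simp add: DERIV_def)
  next
    case False
    then consider "y > 0" | "y < 0" by linarith
    then show ?thesis
    proof cases
      case 1
      have "((\<lambda>y. y\<^sup>2) has_real_derivative 2 * max 0 y) (at y)"
        using 1 by (auto intro!: derivative_eq_intros)
      then show ?thesis
        by (rule has_field_derivative_transform_within_open[where S = "{0<..}"]) (use 1 in auto)
    next
      case 2
      have "((\<lambda>y. 0) has_real_derivative 2 * max 0 y) (at y)"
        using 2 by (auto intro!: derivative_eq_intros)
      then show ?thesis
        by (rule has_field_derivative_transform_within_open[where S = "{..<0}"]) (use 2 in auto)
    qed
  qed
  have dm: "((\<lambda>y. (m n y)\<^sup>2) has_real_derivative 2 * m n y) (at y)" for n y
  proof -
    have "((\<lambda>y. y - 1 / real (Suc n)) has_real_derivative 1) (at y)"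
      by (auto intro!: derivative_eq_intros)
    from DERIV_chain2[OF sq this] show ?thesis by (simp add: m_def)
  qed
  have dD: "(D n has_real_derivative real (Suc n) * (2 * m n y)) (at y)" for n y
    unfolding D_def by (rule DERIV_cong, rule derivative_intros, rule derivative_intros, rule DERIV_cmult[OF dm]) simp
  show thesis
  proof
    show "(\<tau> n has_real_derivative \<tau>' n y) (at y)" for n y
      unfolding \<tau>_def \<tau>'_def
      by (rule DERIV_cong, rule DERIV_diff[OF DERIV_const DERIV_divide[OF DERIV_const dD Dnz]])
        (simp add: power2_eq_square)
    show "continuous_on UNIV (\<tau>' n)" for n
      unfolding \<tau>'_def using Dnz unfolding D_def m_def by (intro continuous_intros) auto
    show "0 \<le> \<tau> n y" "\<tau> n y \<le> 1" for n y using D[of n y] by (auto simp: \<tau>_def)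
    show "\<tau> n y = 0" if "y \<le> 1 / real (Suc n)" for n y
      using that by (simp add: \<tau>_def D_def m_def)
    show "(\<lambda>n. \<tau> n y) \<longlonglongrightarrow> (if y > 0 then 1 else 0)" for y
    proof (cases "y > 0")
      case True
      have s: "filterlim (\<lambda>n. real (Suc n)) at_top sequentially"
        by (rule filterlim_compose[OF filterlim_real_sequentially filterlim_Suc])
      have "(\<lambda>n. 1 / real (Suc n)) \<longlonglongrightarrow> 0"
        by (rule LIMSEQ_Suc[OF lim_1_over_n])
      then have "(\<lambda>n. m n y) \<longlonglongrightarrow> max 0 (y - 0)"
        unfolding m_def by (intro tendsto_intros)
      then have "(\<lambda>n. (m n y)\<^sup>2) \<longlonglongrightarrow> y\<^sup>2"
        using True by (intro tendsto_power) simp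
      then have "filterlim (\<lambda>n. (m n y)\<^sup>2 * real (Suc n)) at_top sequentially"
        by (rule filterlim_tendsto_pos_mult_at_top) (use True s in auto)
      then have "filterlim (\<lambda>n. D n y) at_top sequentially"
        unfolding D_def by (intro filterlim_tendsto_add_at_top[OF tendsto_const]) (simp add: mult.commute)
      then have "(\<lambda>n. 1 - inverse (D n y)) \<longlonglongrightarrow> 1 - 0"
        by (intro tendsto_diff tendsto_const tendsto_inverse_0_at_top)
      then show ?thesis using True by (simp add: \<tau>_def inverse_eq_divide)
    next
      case False
      then have "\<tau> n y = 0" for n
        using order_trans[of y 0 "1 / real (Suc n)"] by (simp add: \<tau>_def D_def m_def)
      then show ?thesis using False by simp
    qed
  qed
qed

lemma C1_cyl_product:
  assumes f: "\<And>s. (f has_real_derivative f' s) (at s)" "continuous_on UNIV f'"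
    and g: "\<And>t. (g has_real_derivative g' t) (at t)" "continuous_on UNIV g'"
    and per: "\<And>t. g (t + 2 * pi) = g t"
  shows "C1_cyl (\<lambda>p. f (fst p) * g (snd p)) (\<lambda>p. f' (fst p) * g (snd p)) (\<lambda>p. f (fst p) * g' (snd p))"
  unfolding C1_cyl_def
proof (intro conjI allI)
  have fc: "continuous_on UNIV f" and gc: "continuous_on UNIV g"
    using f(1) g(1) by (meson DERIV_isCont continuous_at_imp_continuous_on)+
  show "continuous_on UNIV (\<lambda>p. f' (fst p) * g (snd p))" "continuous_on UNIV (\<lambda>p. f (fst p) * g' (snd p))"
    by (intro continuous_intros continuous_on_compose2[OF fc] continuous_on_compose2[OF gc]
      continuous_on_compose2[OF f(2)] continuous_on_compose2[OF g(2)]; simp)+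
  show "f (fst (s, \<theta> + 2 * pi)) * g (snd (s, \<theta> + 2 * pi)) = f (fst (s, \<theta>)) * g (snd (s, \<theta>))" for s \<theta>
    by (simp add: per)
  show "((\<lambda>p. f (fst p) * g (snd p)) has_derivative
      (\<lambda>h. fst h * (f' (fst p) * g (snd p)) + snd h * (f (fst p) * g' (snd p)))) (at p)" for p
  proof -
    have "((\<lambda>p. f (fst p)) has_derivative (\<lambda>h. f' (fst p) * fst h)) (at p)"
      by (rule has_derivative_compose[OF _ f(1)[unfolded has_field_derivative_def], of fst fst, simplified])
        (auto intro!: derivative_eq_intros)
    moreover have "((\<lambda>p. g (snd p)) has_derivative (\<lambda>h. g' (snd p) * snd h)) (at p)"
      by (rule has_derivative_compose[OF _ g(1)[unfolded has_field_derivative_def], of snd snd, simplified])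
        (auto intro!: derivative_eq_intros)
    ultimately show ?thesis
      by (rule has_derivative_eq_rhs[OF has_derivative_mult]) (auto simp: algebra_simps)
  qed
qed

text \<open>The test functions are products of step approximations composed with \<open>(s - \<alpha>) (\<beta> - s)\<close> and
  with \<open>sin ((\<theta> - \<gamma>)/2) sin ((\<delta> - \<theta>)/2)\<close>.  The latter is \<open>2\<pi>\<close>-periodic, and in one period it is
  positive precisely between \<open>\<gamma>\<close> and \<open>\<delta>\<close>.  In the limit they give the indicator of a box, so
  every such box has integral zero.\<close>

lemma cylinder_fundamental_lemma:
  fixes h :: "real \<times> real \<Rightarrow> real"
  assumes L: "L > 0" and int: "set_integrable lborel ({- L..L} \<times> {0..2 * pi}) h"
    and test: "\<And>\<psi> \<psi>s \<psi>t. C1_cyl \<psi> \<psi>s \<psi>t \<Longrightarrow> \<exists>d>0. \<forall>s \<theta>. \<bar>s\<bar> > L - d \<longrightarrow> \<psi> (s, \<theta>) = 0 \<Longrightarrow>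
      (LINT p:{- L..L} \<times> {0..2 * pi}|lborel. h p * \<psi> p) = 0"
  shows "AE p in lborel. p \<in> {- L..L} \<times> {0..2 * pi} \<longrightarrow> h p = 0"
proof -
  let ?R = "{- L..L} \<times> {0..2 * pi}"
  let ?l = "(- L, 0) :: real \<times> real" and ?u = "(L, 2 * pi)"
  have sub: "box ?l ?u \<subseteq> ?R" by (auto simp: box_prod)
  have "AE p in lborel. p \<in> box ?l ?u \<longrightarrow> h p = 0"
  proof (rule AE_zero_if_box_integrals_zero)
    show "set_integrable lborel (box ?l ?u) h"
      by (rule set_integrable_subset[OF int _ sub]) simp
    fix l u :: "real \<times> real" assume lu: "box l u \<subseteq> box ?l ?u"
    obtain \<alpha> \<gamma> \<beta> \<delta> where eq: "l = (\<alpha>, \<gamma>)" "u = (\<beta>, \<delta>)" by (cases l, cases u)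
    show "(LINT x:box l u|lborel. h x) = 0"
    proof (cases "box l u = {}")
      case True then show ?thesis by (simp add: set_lebesgue_integral_def)
    next
      case False
      then have ab: "\<alpha> < \<beta>" "\<gamma> < \<delta>" by (auto simp: eq box_prod)
      then have bd: "- L \<le> \<alpha>" "\<beta> \<le> L" "0 \<le> \<gamma>" "\<delta> \<le> 2 * pi"
        using lu by (auto simp: eq box_prod times_subset_iff greaterThanLessThan_subseteq_greaterThanLessThan)
      obtain \<tau> \<tau>' :: "nat \<Rightarrow> real \<Rightarrow> real" where
        \<tau>d: "\<And>n y. (\<tau> n has_real_derivative \<tau>' n y) (at y)" and \<tau>c: "\<And>n. continuous_on UNIV (\<tau>' n)"
        and \<tau>b: "\<And>n y. 0 \<le> \<tau> n y" "\<And>n y. \<tau> n y \<le> 1"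
        and \<tau>0: "\<And>n y. y \<le> 1 / real (Suc n) \<Longrightarrow> \<tau> n y = 0"
        and \<tau>l: "\<And>y. (\<lambda>n. \<tau> n y) \<longlonglongrightarrow> (if y > 0 then 1 else 0)"
        by (rule C1_step_approximation) blast
      define e where "e = (\<lambda>s. (s - \<alpha>) * (\<beta> - s))"
      define e' where "e' = (\<lambda>s. \<alpha> + \<beta> - 2 * s)"
      define w where "w = (\<lambda>t. sin ((t - \<gamma>) / 2) * sin ((\<delta> - t) / 2))"
      define w' where "w' = (\<lambda>t. cos ((t - \<gamma>) / 2) / 2 * sin ((\<delta> - t) / 2) - sin ((t - \<gamma>) / 2) * cos ((\<delta> - t) / 2) / 2)"
      have de: "(e has_real_derivative e' s) (at s)" for s
        unfolding e_def e'_def by (auto intro!: derivative_eq_intros simp: algebra_simps)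
      have dw: "(w has_real_derivative w' t) (at t)" for t
        unfolding w_def w'_def by (auto intro!: derivative_eq_intros simp: algebra_simps)
      have ce: "continuous_on UNIV e" "continuous_on UNIV e'" and cw: "continuous_on UNIV w" "continuous_on UNIV w'"
        unfolding e_def e'_def w_def w'_def by (intro continuous_intros; simp)+
      have wper: "w (t + 2 * pi) = w t" for t
      proof -
        have "(t + 2 * pi - \<gamma>) / 2 = (t - \<gamma>) / 2 + pi" "(\<delta> - (t + 2 * pi)) / 2 = (\<delta> - t) / 2 - pi"
          by (simp_all add: field_simps)
        then show ?thesis by (simp only: w_def sin_periodic_pi sin_minus_pi minus_mult_minus)
      qed
      define \<psi> where "\<psi> = (\<lambda>n p. \<tau> n (e (fst p)) * \<tau> n (w (snd p)))"
      have C1: "C1_cyl (\<psi> n) (\<lambda>p. \<tau>' n (e (fst p)) * e' (fst p) * \<tau> n (w (snd p)))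
          (\<lambda>p. \<tau> n (e (fst p)) * (\<tau>' n (w (snd p)) * w' (snd p)))" for n
        unfolding \<psi>_def
        by (rule C1_cyl_product; (rule DERIV_chain2[OF \<tau>d de] DERIV_chain2[OF \<tau>d dw] | simp only: wper
          | (intro continuous_intros continuous_on_compose2[OF \<tau>c] ce cw; simp)))
      have e_small: "e s \<le> 1 / real (Suc n)" if s: "\<bar>s\<bar> > L - 1 / (real (Suc n) * (2 * L))" for s n
      proof -
        let ?d = "1 / (real (Suc n) * (2 * L))"
        have d: "0 < ?d" "2 * L * ?d = 1 / real (Suc n)" using L by simp_all
        consider "s < \<alpha>" | "\<beta> < s" | "\<alpha> \<le> s" "s \<le> \<beta>" by linarith
        then show ?thesis
        proof cases
          case 1
          then have "e s \<le> 0" using ab by (auto simp: e_def intro!: mult_nonpos_nonneg)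
          then show ?thesis by (rule order_trans) simp
        next
          case 2
          then have "e s \<le> 0" using ab by (auto simp: e_def intro!: mult_nonneg_nonpos)
          then show ?thesis by (rule order_trans) simp
        next
          case 3
          have "s - \<alpha> \<le> ?d \<or> \<beta> - s \<le> ?d" using s bd by linarith
          then have "e s \<le> 2 * L * ?d"
          proof
            assume "s - \<alpha> \<le> ?d"
            then have "(s - \<alpha>) * (\<beta> - s) \<le> ?d * (2 * L)"
              using 3 bd d(1) by (intro mult_mono) auto
            then show ?thesis by (simp add: e_def mult.commute)
          next
            assume "\<beta> - s \<le> ?d"
            then have "(s - \<alpha>) * (\<beta> - s) \<le> (2 * L) * ?d"
              using 3 bd L by (intro mult_mono) auto
            then show ?thesis by (simp add: e_def)
          qed
          then show ?thesis using d(2) by simp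
        qed
      qed
      have supp: "\<exists>d>0. \<forall>s \<theta>. \<bar>s\<bar> > L - d \<longrightarrow> \<psi> n (s, \<theta>) = 0" for n
        using e_small[of n] \<tau>0 L
        by (intro exI[of _ "1 / (real (Suc n) * (2 * L))"]) (auto simp: \<psi>_def)
      have zero: "(LINT p:?R|lborel. h p * \<psi> n p) = 0" for n
        by (rule test[OF C1 supp])
      have e_pos: "e s > 0 \<longleftrightarrow> \<alpha> < s \<and> s < \<beta>" for s
        using ab by (auto simp: e_def zero_less_mult_iff)
      have w_pos: "w t > 0 \<longleftrightarrow> \<gamma> < t \<and> t < \<delta>" if t: "0 \<le> t" "t \<le> 2 * pi" for t
      proof -
        have odd: "sin ((x - y) / 2) = - sin ((y - x) / 2)" for x y :: real
          by (metis minus_diff_eq minus_divide_left sin_minus)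
        consider "t \<le> \<gamma>" | "\<delta> \<le> t" | "\<gamma> < t" "t < \<delta>" by linarith
        then show ?thesis
        proof cases
          case 1
          have "sin ((t - \<gamma>) / 2) \<le> 0" "sin ((\<delta> - t) / 2) \<ge> 0"
            using 1 ab bd t sin_ge_zero[of "(\<gamma> - t) / 2"] odd[of t \<gamma>]
            by (auto intro!: sin_ge_zero)
          then have "w t \<le> 0" by (simp add: w_def mult_nonpos_nonneg)
          then show ?thesis using 1 by simp
        next
          case 2
          have "sin ((t - \<gamma>) / 2) \<ge> 0" "sin ((\<delta> - t) / 2) \<le> 0"
            using 2 ab bd t sin_ge_zero[of "(t - \<delta>) / 2"] odd[of \<delta> t]
            by (auto intro!: sin_ge_zero)
          then have "w t \<le> 0" by (simp add: w_def mult_nonneg_nonpos)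
          then show ?thesis using 2 by simp
        next
          case 3
          then have "w t > 0"
            unfolding w_def using bd t by (intro mult_pos_pos sin_gt_zero) auto
          then show ?thesis using 3 by simp
        qed
      qed
      have hm: "(\<lambda>p. indicator ?R p * h p) \<in> borel_measurable lborel"
        and hi: "integrable lborel (\<lambda>p. indicator ?R p * h p)"
        using int by (auto simp: set_integrable_def)
      have \<psi>m: "\<psi> n \<in> borel_measurable lborel" for n
      proof -
        have "continuous_on UNIV (\<psi> n)"
          using C1[of n] unfolding C1_cyl_def
          by (meson has_derivative_continuous continuous_at_imp_continuous_on)
        then show ?thesis by (simp add: borel_measurable_continuous_onI)
      qed
      have lim: "(\<lambda>n. \<psi> n p) \<longlonglongrightarrow> indicator (box l u) p" if "p \<in> ?R" for p
      proof -
        have "(\<lambda>n. \<psi> n p) \<longlonglongrightarrow> (if e (fst p) > 0 then 1 else 0) * (if w (snd p) > 0 then 1 else 0)"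
          unfolding \<psi>_def by (intro tendsto_mult \<tau>l)
        also have "(if e (fst p) > 0 then 1 else 0) * (if w (snd p) > 0 then 1 else 0) = (indicator (box l u) p :: real)"
          using that e_pos w_pos by (cases p) (auto simp: eq box_prod indicator_def)
        finally show ?thesis .
      qed
      have "(\<lambda>n. LINT p|lborel. indicator ?R p * h p * \<psi> n p) \<longlonglongrightarrow>
          (LINT p|lborel. indicator ?R p * h p * indicator (box l u) p)"
      proof (rule integral_dominated_convergence)
        show "(\<lambda>p. indicator ?R p * h p * indicator (box l u) p) \<in> borel_measurable lborel"
          using hm by measurable
        show "(\<lambda>p. indicator ?R p * h p * \<psi> n p) \<in> borel_measurable lborel" for n
          using hm \<psi>m by measurable
        show "integrable lborel (\<lambda>p. norm (indicator ?R p * h p))"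
          using hi by (rule integrable_norm)
        show "AE p in lborel. (\<lambda>n. indicator ?R p * h p * \<psi> n p) \<longlonglongrightarrow>
            indicator ?R p * h p * indicator (box l u) p"
          using lim by (intro AE_I2) (auto simp: indicator_def[of ?R] intro!: tendsto_mult)
        show "AE p in lborel. norm (indicator ?R p * h p * \<psi> n p) \<le> norm (indicator ?R p * h p)" for n
        proof (rule AE_I2)
          fix p
          have "norm (\<psi> n p) \<le> 1"
            using \<tau>b by (auto simp: \<psi>_def abs_mult intro!: mult_le_one)
          then show "norm (indicator ?R p * h p * \<psi> n p) \<le> norm (indicator ?R p * h p)"
            unfolding norm_mult[of _ "\<psi> n p"] by (intro mult_right_le_one_le) auto
        qed
      qed
      moreover have "(LINT p|lborel. indicator ?R p * h p * \<psi> n p) = 0" for n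
        using zero[of n] by (simp add: set_lebesgue_integral_def mult.assoc)
      ultimately have "(LINT p|lborel. indicator ?R p * h p * indicator (box l u) p) = 0"
        by (simp add: LIMSEQ_const_iff)
      moreover have "(LINT p|lborel. indicator ?R p * h p * indicator (box l u) p) = (LINT x:box l u|lborel. h x)"
        unfolding set_lebesgue_integral_def using lu sub
        by (intro Bochner_Integration.integral_cong) (auto simp: indicator_def)
      ultimately show ?thesis by simp
    qed
  qed
  then show ?thesis
    using AE_cbox_interior[of ?l ?u] unfolding rectangle_eq_cbox by eventually_elim auto
qed

section \<open>Weak derivatives of continuously differentiable functions\<close>

lemma C1_cylD:
  assumes "C1_cyl f fs ft"
  shows "\<And>s t. f (s, t + 2 * pi) = f (s, t)"
    and "\<And>s t. ((\<lambda>s. f (s, t)) has_real_derivative fs (s, t)) (at s)"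
    and "\<And>s t. ((\<lambda>t. f (s, t)) has_real_derivative ft (s, t)) (at t)"
    and "continuous_on UNIV f" "continuous_on UNIV fs" "continuous_on UNIV ft"
proof -
  have d: "(f has_derivative (\<lambda>h. fst h * fs p + snd h * ft p)) (at p)" for p
    using assms unfolding C1_cyl_def by blast
  show "((\<lambda>s. f (s, t)) has_real_derivative fs (s, t)) (at s)" for s t
  proof -
    have "((\<lambda>s. (s, t)) has_derivative (\<lambda>h. (h, 0))) (at s)"
      by (auto intro!: derivative_eq_intros)
    from has_derivative_compose[OF this d] show ?thesis
      by (simp add: has_field_derivative_def mult_commute_abs)
  qed
  show "((\<lambda>t. f (s, t)) has_real_derivative ft (s, t)) (at t)" for s t
  proof -
    have "((\<lambda>t. (s, t)) has_derivative (\<lambda>h. (0, h))) (at t)"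
      by (auto intro!: derivative_eq_intros)
    from has_derivative_compose[OF this d] show ?thesis
      by (simp add: has_field_derivative_def mult_commute_abs)
  qed
  show "continuous_on UNIV f"
    using d by (meson has_derivative_continuous continuous_at_imp_continuous_on)
qed (use assms in \<open>simp_all add: C1_cyl_def\<close>)

lemma C1_cyl_add:
  assumes "C1_cyl f fs ft" "C1_cyl g gs gt"
  shows "C1_cyl (\<lambda>p. f p + g p) (\<lambda>p. fs p + gs p) (\<lambda>p. ft p + gt p)"
  using assms unfolding C1_cyl_def
  by (auto intro!: continuous_on_add has_derivative_eq_rhs[OF has_derivative_add] simp: algebra_simps)

lemma C1_cyl_diff:
  assumes "C1_cyl f fs ft" "C1_cyl g gs gt"
  shows "C1_cyl (\<lambda>p. f p - g p) (\<lambda>p. fs p - gs p) (\<lambda>p. ft p - gt p)"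
  using assms unfolding C1_cyl_def
  by (auto intro!: continuous_on_diff has_derivative_eq_rhs[OF has_derivative_diff] simp: algebra_simps)

lemma C1_cyl_mult:
  assumes "C1_cyl f fs ft" "C1_cyl g gs gt"
  shows "C1_cyl (\<lambda>p. f p * g p) (\<lambda>p. fs p * g p + f p * gs p) (\<lambda>p. ft p * g p + f p * gt p)"
  using assms C1_cylD(4)[OF assms(1)] C1_cylD(4)[OF assms(2)] unfolding C1_cyl_def
  by (auto intro!: continuous_on_add continuous_on_mult has_derivative_eq_rhs[OF has_derivative_mult]
      simp: algebra_simps)

context
  fixes a :: real
  assumes a: "a > 1/2"
begin

lemma cell_sets: "cell a \<in> sets lborel"
  unfolding cell_def rectangle_eq_cbox by simp

lemma continuous_on_catB_fst: "continuous_on X (\<lambda>p::real \<times> real. catB a (fst p))"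
  by (rule continuous_on_compose2[OF continuous_on_cat(2)[OF a, of UNIV]])
    (auto intro: continuous_on_fst continuous_on_id)

lemma catB_measurable: "(\<lambda>p::real \<times> real. catB a (fst p)) \<in> borel_measurable borel"
  by (intro borel_measurable_continuous_onI continuous_on_catB_fst)

lemma catB_ge: "catB a 0 \<le> catB a s"
  using a cosh_real_ge_1[of "2 * s"] by (simp add: catB_def)

lemma AE_area: "(AE p in area a. P p) \<longleftrightarrow> (AE p in lborel. p \<in> cell a \<longrightarrow> P p)"
proof -
  have m: "(\<lambda>p. ennreal (catB a (fst p))) \<in> borel_measurable (restrict_space lborel (cell a))"
    using catB_measurable by (intro measurable_restrict_space1) simp
  show ?thesis
    unfolding area_def using cell_sets
    by (subst AE_density[OF m], subst AE_restrict_space_iff) (simp_all add: cat_pos(2)[OF a])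
qed

lemma measurable_area: "f \<in> borel_measurable borel \<Longrightarrow> f \<in> borel_measurable (area a)"
  unfolding area_def by (simp add: measurable_restrict_space1)

lemma continuous_measurable_area:
  fixes f :: "real \<times> real \<Rightarrow> real"
  shows "continuous_on UNIV f \<Longrightarrow> f \<in> borel_measurable (area a)"
  by (intro measurable_area borel_measurable_continuous_onI)

lemma
  fixes f :: "real \<times> real \<Rightarrow> real"
  assumes f: "f \<in> borel_measurable (area a)"
  shows area_integral: "(LINT p|area a. f p) = (LINT p:cell a|lborel. catB a (fst p) * f p)"
    and area_integrable: "integrable (area a) f \<longleftrightarrow> set_integrable lborel (cell a) (\<lambda>p. catB a (fst p) * f p)"
proof -
  have m: "f \<in> borel_measurable (restrict_space lborel (cell a))"
    using f by (simp add: area_def)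
  have b: "(\<lambda>p. catB a (fst p)) \<in> borel_measurable (restrict_space lborel (cell a))"
    using catB_measurable by (intro measurable_restrict_space1) simp
  have nn: "AE p in restrict_space lborel (cell a). 0 \<le> catB a (fst p)"
    using cat_pos(2)[OF a] by (simp add: less_imp_le)
  show "(LINT p|area a. f p) = (LINT p:cell a|lborel. catB a (fst p) * f p)"
    unfolding area_def integral_density[OF m b nn] set_lebesgue_integral_def
    using cell_sets by (subst integral_restrict_space) simp_all
  show "integrable (area a) f \<longleftrightarrow> set_integrable lborel (cell a) (\<lambda>p. catB a (fst p) * f p)"
    unfolding area_def integrable_density[OF m b nn] set_integrable_def
    using cell_sets by (subst integrable_restrict_space) simp_all
qed

lemma set_integrable_cell: "continuous_on UNIV f \<Longrightarrow> set_integrable lborel (cell a) f"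
  for f :: "real \<times> real \<Rightarrow> real"
  unfolding cell_def by (rule set_integrable_rectangle) (auto intro: continuous_on_subset)

lemma continuous_integrable_area:
  fixes f :: "real \<times> real \<Rightarrow> real"
  assumes "continuous_on UNIV f"
  shows "integrable (area a) f"
  using assms by (subst area_integrable)
    (auto intro!: continuous_measurable_area set_integrable_cell continuous_on_mult continuous_on_catB_fst)

lemma continuous_L2: "continuous_on UNIV U \<Longrightarrow> L2 a U"
  unfolding L2_def by (auto intro!: continuous_measurable_area continuous_integrable_area continuous_on_power)

text \<open>\<open>2 |V| \<le> 1 + V\<^sup>2\<close>, and the density \<open>B\<close> of the area measure is at least \<open>B(0) > 0\<close>.\<close>

lemma L2_imp_set_integrable:
  assumes "L2 a V"
  shows "set_integrable lborel (cell a) V"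
proof -
  have V: "V \<in> borel_measurable (area a)" "integrable (area a) (\<lambda>p. (V p)\<^sup>2)"
    using assms by (simp_all add: L2_def)
  have "integrable (area a) (\<lambda>p. 1 + (V p)\<^sup>2)"
    using continuous_integrable_area[of "\<lambda>_. 1"] V(2) by auto
  then have i: "set_integrable lborel (cell a) (\<lambda>p. catB a (fst p) * (1 + (V p)\<^sup>2))"
    using V(1) by (subst (asm) area_integrable) auto
  have "V \<in> borel_measurable (restrict_space lborel (cell a))"
    using V(1) by (simp add: area_def)
  then have m: "(\<lambda>p. indicator (cell a) p *\<^sub>R V p) \<in> borel_measurable lborel"
    using cell_sets by (subst (asm) borel_measurable_restrict_space_iff) simp_all
  have B0: "catB a 0 > 0" using cat_pos(2)[OF a] .
  have bound: "norm (V p) \<le> norm (catB a (fst p) * (1 + (V p)\<^sup>2) / catB a 0)" for p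
  proof -
    have "2 * \<bar>V p\<bar> \<le> 1 + (V p)\<^sup>2"
      using zero_le_power2[of "\<bar>V p\<bar> - 1"] by (simp add: power2_diff)
    then have "\<bar>V p\<bar> * catB a 0 \<le> (1 + (V p)\<^sup>2) * catB a (fst p)"
      using catB_ge[of "fst p"] B0 by (intro mult_mono) auto
    then show ?thesis using B0 cat_pos(2)[OF a, of "fst p"]
      by (simp add: abs_mult pos_le_divide_eq mult.commute)
  qed
  have "set_integrable lborel (cell a) (\<lambda>p. catB a (fst p) * (1 + (V p)\<^sup>2) / catB a 0)"
    using i by (rule set_integrable_divide)
  then show ?thesis
    unfolding set_integrable_def
    by (rule Bochner_Integration.integrable_bound[OF _ m])
      (use bound in \<open>auto intro!: AE_I2 simp: indicator_def\<close>)
qed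

lemma cell_integral_deriv_s:
  assumes "\<And>s t. ((\<lambda>s. F (s, t)) has_real_derivative F' (s, t)) (at s)" "continuous_on UNIV F'"
  shows "(LINT p:cell a|lborel. F' p) = (LINT t:{0..2 * pi}|lborel. F (cat_s0 a, t) - F (- cat_s0 a, t))"
  unfolding cell_def
  by (rule rectangle_integral_deriv_fst[OF _ assms]) (use cat_s0_props(1)[OF a] in simp)

lemma cell_integral_deriv_t:
  assumes "\<And>s t. ((\<lambda>t. F (s, t)) has_real_derivative F' (s, t)) (at t)" "continuous_on UNIV F'"
    and "\<And>s t. F (s, t + 2 * pi) = F (s, t)"
  shows "(LINT p:cell a|lborel. F' p) = 0"
  unfolding cell_def
  by (subst rectangle_integral_deriv_snd[OF _ assms(1,2)])
    (use assms(3)[of _ 0] in \<open>simp_all add: set_lebesgue_integral_def\<close>)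

text \<open>Integration by parts: the boundary terms vanish at \<open>s = \<plusminus>s\<^sub>0\<close> because of the support of
  the test function, and at \<open>\<theta> = 0, 2\<pi>\<close> because of periodicity.\<close>

lemma C1_weak_derivs:
  assumes U: "C1_cyl U Us Ut"
  shows "weak_derivs a U Us Ut"
  unfolding weak_derivs_def
proof (intro conjI allI impI)
  note UD = C1_cylD[OF U]
  show "L2 a Us" "L2 a Ut" using UD(5,6) by (auto intro: continuous_L2)
  fix \<psi> \<psi>s \<psi>t
  assume "C1_cyl \<psi> \<psi>s \<psi>t \<and> (\<exists>d>0. \<forall>s \<theta>. cat_s0 a - d < \<bar>s\<bar> \<longrightarrow> \<psi> (s, \<theta>) = 0)"
  then obtain d where \<psi>: "C1_cyl \<psi> \<psi>s \<psi>t" and d: "d > 0" "\<And>s t. cat_s0 a - d < \<bar>s\<bar> \<Longrightarrow> \<psi> (s, t) = 0" by blast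
  note D = C1_cylD[OF \<psi>]
  note P = C1_cylD[OF C1_cyl_mult[OF U \<psi>]]
  have z: "\<psi> (cat_s0 a, t) = 0" "\<psi> (- cat_s0 a, t) = 0" for t
    using d cat_s0_props(1)[OF a] by auto
  have i: "set_integrable lborel (cell a) (\<lambda>p. f p * g p)"
    if "continuous_on UNIV f" "continuous_on UNIV g" for f g :: "real \<times> real \<Rightarrow> real"
    using that by (intro set_integrable_cell continuous_on_mult)
  have "(LINT p:cell a|lborel. Us p * \<psi> p + U p * \<psi>s p) = 0"
    by (subst cell_integral_deriv_s[OF P(2,5)]) (simp add: z set_lebesgue_integral_def)
  then show "(LINT p:cell a|lborel. U p * \<psi>s p) = - (LINT p:cell a|lborel. Us p * \<psi> p)"
    using set_integral_add(2)[OF i[OF UD(5) D(4)] i[OF UD(4) D(5)]] by simp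
  have "(LINT p:cell a|lborel. Ut p * \<psi> p + U p * \<psi>t p) = 0"
    by (rule cell_integral_deriv_t[OF P(3,6,1)])
  then show "(LINT p:cell a|lborel. U p * \<psi>t p) = - (LINT p:cell a|lborel. Ut p * \<psi> p)"
    using set_integral_add(2)[OF i[OF UD(6) D(4)] i[OF UD(4) D(6)]] by simp
qed

text \<open>Two weak derivatives have the same integrals against all test functions, so their difference,
  which is integrable over the cell, vanishes by the fundamental lemma.\<close>

lemma weak_derivs_unique:
  assumes 1: "weak_derivs a U V W" and 2: "weak_derivs a U V' W'"
  shows "AE p in area a. V p = V' p" "AE p in area a. W p = W' p"
proof -
  have key: "AE p in area a. X p = Y p"
    if X: "L2 a X" and Y: "L2 a Y"
      and eq: "\<And>\<psi> \<psi>s \<psi>t. C1_cyl \<psi> \<psi>s \<psi>t \<Longrightarrow> \<exists>d>0. \<forall>s \<theta>. \<bar>s\<bar> > cat_s0 a - d \<longrightarrow> \<psi> (s, \<theta>) = 0 \<Longrightarrow>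
        (LINT p:cell a|lborel. X p * \<psi> p) = (LINT p:cell a|lborel. Y p * \<psi> p)" for X Y
  proof -
    have "AE p in lborel. p \<in> cell a \<longrightarrow> X p - Y p = 0"
      unfolding cell_def
    proof (rule cylinder_fundamental_lemma, goal_cases)
      case 1 show ?case by (rule cat_s0_props(1)[OF a])
    next
      case 2
      show ?case using X Y unfolding cell_def[symmetric] by (intro set_integral_diff L2_imp_set_integrable)
    next
      case (3 \<psi> \<psi>s \<psi>t)
      have i: "set_integrable lborel (cell a) (\<lambda>p. Z p * \<psi> p)" if "L2 a Z" for Z
      proof -
        have c: "continuous_on UNIV \<psi>" by (rule C1_cylD(4)[OF 3(1)])
        have "compact (cell a)" unfolding cell_def rectangle_eq_cbox by (rule compact_cbox)
        then have "bounded (\<psi> ` cell a)"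
          by (intro compact_imp_bounded compact_continuous_image continuous_on_subset[OF c]) auto
        then obtain M where M: "\<And>p. p \<in> cell a \<Longrightarrow> norm (\<psi> p) \<le> M"
          unfolding bounded_iff by auto
        have "set_integrable lborel (cell a) (\<lambda>p. M * Z p)"
          using L2_imp_set_integrable[OF that] by (intro set_integrable_mult_right) auto
        then show ?thesis
          unfolding set_integrable_def
        proof (rule Bochner_Integration.integrable_bound)
          have "(\<lambda>p. indicator (cell a) p *\<^sub>R Z p) \<in> borel_measurable lborel"
            using L2_imp_set_integrable[OF that] by (auto simp: set_integrable_def)
          moreover have "\<psi> \<in> borel_measurable lborel"
            using c by (simp add: borel_measurable_continuous_onI)
          ultimately have "(\<lambda>p. (indicator (cell a) p *\<^sub>R Z p) * \<psi> p) \<in> borel_measurable lborel"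
            by (rule borel_measurable_times)
          then show "(\<lambda>p. indicator (cell a) p *\<^sub>R (Z p * \<psi> p)) \<in> borel_measurable lborel"
            by (simp add: mult.assoc)
          show "AE p in lborel. norm (indicator (cell a) p *\<^sub>R (Z p * \<psi> p))
              \<le> norm (indicator (cell a) p *\<^sub>R (M * Z p))"
          proof (rule AE_I2)
            fix p
            have "\<bar>\<psi> p\<bar> * \<bar>Z p\<bar> \<le> \<bar>M\<bar> * \<bar>Z p\<bar>" if "p \<in> cell a"
              using M[OF that] by (intro mult_right_mono) auto
            then show "norm (indicator (cell a) p *\<^sub>R (Z p * \<psi> p))
              \<le> norm (indicator (cell a) p *\<^sub>R (M * Z p))"
              by (auto simp: indicator_def abs_mult mult.commute)
          qed
        qed
      qed
      have "(LINT p:cell a|lborel. X p * \<psi> p - Y p * \<psi> p) = 0"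
        using eq[OF 3] by (subst set_integral_diff(2)[OF i[OF X] i[OF Y]]) simp
      then show ?case by (simp add: cell_def left_diff_distrib)
    qed
    then show ?thesis by (simp add: AE_area)
  qed
  have L2: "L2 a V" "L2 a W" "L2 a V'" "L2 a W'"
    using 1 2 by (auto simp: weak_derivs_def)
  have test: "(LINT p:cell a|lborel. U p * \<psi>s p) = - (LINT p:cell a|lborel. X p * \<psi> p)"
    "(LINT p:cell a|lborel. U p * \<psi>t p) = - (LINT p:cell a|lborel. Y p * \<psi> p)"
    if "weak_derivs a U X Y" "C1_cyl \<psi> \<psi>s \<psi>t" "\<exists>d>0. \<forall>s \<theta>. \<bar>s\<bar> > cat_s0 a - d \<longrightarrow> \<psi> (s, \<theta>) = 0"
    for X Y \<psi> \<psi>s \<psi>t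
    using that unfolding weak_derivs_def by blast+
  show "AE p in area a. V p = V' p"
    by (rule key[OF L2(1,3)]) (use test(1)[OF 1] test(1)[OF 2] in fastforce)
  show "AE p in area a. W p = W' p"
    by (rule key[OF L2(2,4)]) (use test(2)[OF 1] test(2)[OF 2] in fastforce)
qed

end

section \<open>Traces and the index form for continuously differentiable functions\<close>

lemma square_integrable_diff:
  fixes T c :: "real \<Rightarrow> real"
  assumes T: "set_borel_measurable lborel {l..r} T" "set_integrable lborel {l..r} (\<lambda>t. (T t)\<^sup>2)"
    and c: "continuous_on UNIV c"
  shows "set_integrable lborel {l..r} (\<lambda>t. (c t - T t)\<^sup>2)"
proof -
  have "set_integrable lborel {l..r} (\<lambda>t. (c t)\<^sup>2)"
    using c by (intro borel_integrable_atLeastAtMost' continuous_on_power) (auto intro: continuous_on_subset)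
  then have "set_integrable lborel {l..r} (\<lambda>t. 2 * (c t)\<^sup>2 + 2 * (T t)\<^sup>2)"
    using T(2) by (intro set_integral_add set_integrable_mult_right)
  then show ?thesis
    unfolding set_integrable_def
  proof (rule Bochner_Integration.integrable_bound)
    have cm: "c \<in> borel_measurable lborel"
      using c by (simp add: borel_measurable_continuous_onI)
    have "(\<lambda>t. (indicator {l..r} t *\<^sub>R c t - indicator {l..r} t *\<^sub>R T t)\<^sup>2) \<in> borel_measurable lborel"
      using T(1) cm unfolding set_borel_measurable_def by measurable
    also have "(\<lambda>t. (indicator {l..r} t *\<^sub>R c t - indicator {l..r} t *\<^sub>R T t)\<^sup>2) =
        (\<lambda>t. indicator {l..r} t *\<^sub>R (c t - T t)\<^sup>2)"
      by (auto simp: indicator_def)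
    finally show "(\<lambda>t. indicator {l..r} t *\<^sub>R (c t - T t)\<^sup>2) \<in> borel_measurable lborel" .
    have "(x - y)\<^sup>2 \<le> 2 * x\<^sup>2 + 2 * y\<^sup>2" for x y :: real
      using zero_le_power2[of "x + y"] by (simp add: power2_sum power2_diff)
    then show "AE t in lborel. norm (indicator {l..r} t *\<^sub>R (c t - T t)\<^sup>2) \<le>
        norm (indicator {l..r} t *\<^sub>R (2 * (c t)\<^sup>2 + 2 * (T t)\<^sup>2))"
      by (auto simp: indicator_def)
  qed
qed

lemma continuous_circle:
  fixes f :: "real \<times> real \<Rightarrow> real"
  assumes "continuous_on UNIV f"
  shows "continuous_on UNIV (\<lambda>t. f (\<sigma>, t))"
    and "set_integrable lborel {l..r} (\<lambda>t. f (\<sigma>, t))"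
    and "set_borel_measurable lborel {l..r} (\<lambda>t. f (\<sigma>, t))"
proof -
  show c: "continuous_on UNIV (\<lambda>t. f (\<sigma>, t))"
    by (rule continuous_on_compose2[OF assms]) (auto intro!: continuous_intros)
  show i: "set_integrable lborel {l..r} (\<lambda>t. f (\<sigma>, t))"
    using c by (intro borel_integrable_atLeastAtMost') (auto intro: continuous_on_subset)
  then show "set_borel_measurable lborel {l..r} (\<lambda>t. f (\<sigma>, t))"
    by (auto simp: set_integrable_def set_borel_measurable_def)
qed

context
  fixes a :: real
  assumes a: "a > 1/2"
begin

lemma bdry_integral_eq:
  "bdry_integral a F = catB a (cat_s0 a) *
     ((LINT t:{0..2 * pi}|lborel. F (cat_s0 a, t)) + (LINT t:{0..2 * pi}|lborel. F (- cat_s0 a, t)))"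
proof -
  have "- cat_s0 a \<noteq> cat_s0 a" using cat_s0_props(1)[OF a] by simp
  then show ?thesis
    by (simp add: bdry_integral_def catB_minus[OF a] set_lebesgue_integral_def algebra_simps
        flip: mult.assoc)
qed

lemma bdry_integral_mono:
  assumes "\<And>\<sigma>. \<sigma> \<in> {- cat_s0 a, cat_s0 a} \<Longrightarrow> set_integrable lborel {0..2 * pi} (\<lambda>t. F (\<sigma>, t))"
    and "\<And>\<sigma>. \<sigma> \<in> {- cat_s0 a, cat_s0 a} \<Longrightarrow> set_integrable lborel {0..2 * pi} (\<lambda>t. G (\<sigma>, t))"
    and "\<And>p. F p \<le> G p"
  shows "bdry_integral a F \<le> bdry_integral a G"
  unfolding bdry_integral_eq using assms cat_pos(2)[OF a]
  by (intro mult_left_mono add_mono set_integral_mono) (auto simp: less_imp_le)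

lemma bdry_integral_add:
  assumes "\<And>\<sigma>. \<sigma> \<in> {- cat_s0 a, cat_s0 a} \<Longrightarrow> set_integrable lborel {0..2 * pi} (\<lambda>t. F (\<sigma>, t))"
    and "\<And>\<sigma>. \<sigma> \<in> {- cat_s0 a, cat_s0 a} \<Longrightarrow> set_integrable lborel {0..2 * pi} (\<lambda>t. G (\<sigma>, t))"
  shows "bdry_integral a (\<lambda>p. F p + G p) = bdry_integral a F + bdry_integral a G"
  unfolding bdry_integral_eq using assms by (simp add: set_integral_add algebra_simps)

lemma bdry_integral_cmult: "bdry_integral a (\<lambda>p. c * F p) = c * bdry_integral a F"
  unfolding bdry_integral_eq by (simp add: algebra_simps)

lemma bdry_integral_cong_AE:
  assumes "\<And>\<sigma>. \<sigma> \<in> {- cat_s0 a, cat_s0 a} \<Longrightarrow> AE t in lborel. t \<in> {0..2 * pi} \<longrightarrow> F (\<sigma>, t) = G (\<sigma>, t)"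
    and "\<And>\<sigma>. \<sigma> \<in> {- cat_s0 a, cat_s0 a} \<Longrightarrow> set_borel_measurable lborel {0..2 * pi} (\<lambda>t. F (\<sigma>, t))"
    and "\<And>\<sigma>. \<sigma> \<in> {- cat_s0 a, cat_s0 a} \<Longrightarrow> set_borel_measurable lborel {0..2 * pi} (\<lambda>t. G (\<sigma>, t))"
  shows "bdry_integral a F = bdry_integral a G"
proof -
  have "(LINT t:{0..2 * pi}|lborel. F (\<sigma>, t)) = (LINT t:{0..2 * pi}|lborel. G (\<sigma>, t))"
    if "\<sigma> \<in> {- cat_s0 a, cat_s0 a}" for \<sigma>
    unfolding set_lebesgue_integral_def using assms(1)[OF that]
    by (intro integral_cong_AE assms(2,3)[OF that, unfolded set_borel_measurable_def])
      (auto elim!: eventually_mono simp: indicator_def)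
  then show ?thesis by (simp add: bdry_integral_eq)
qed

lemma continuous_L2_bdry: "continuous_on UNIV U \<Longrightarrow> L2_bdry a U"
  unfolding L2_bdry_def
  by (intro ballI conjI continuous_circle(3) continuous_circle(2)[of "\<lambda>p. (U p)\<^sup>2"]
      continuous_on_power)

text \<open>Integrating \<open>\<partial>\<^sub>s (s g\<^sup>2) = g\<^sup>2 + 2 s g g\<^sub>s\<close> over the cell bounds both boundary circles at once.\<close>

lemma trace_inequality:
  obtains C where "\<And>g gs gt. C1_cyl g gs gt \<Longrightarrow> bdry_integral a (\<lambda>p. (g p)\<^sup>2) \<le>
    C * (LINT p|area a. (g p)\<^sup>2 + (gs p)\<^sup>2 + (gt p)\<^sup>2 / (catB a (fst p))\<^sup>2)"
proof
  fix g gs gt assume g: "C1_cyl g gs gt"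
  define \<rho> where "\<rho> = cat_s0 a"
  have \<rho>: "\<rho> > 0" using cat_s0_props(1)[OF a] by (simp add: \<rho>_def)
  note G = C1_cylD[OF g]
  have B: "catB a s > 0" for s by (rule cat_pos(2)[OF a])
  let ?E = "\<lambda>p. (g p)\<^sup>2 + (gs p)\<^sup>2 + (gt p)\<^sup>2 / (catB a (fst p))\<^sup>2"
  let ?F' = "\<lambda>p. (g p)\<^sup>2 + 2 * fst p * g p * gs p"
  have cE: "continuous_on UNIV ?E"
    using G(4-6) B by (intro continuous_intros continuous_on_catB_fst[OF a]) (auto simp: less_imp_neq[symmetric])
  have cF: "continuous_on UNIV ?F'"
    using G(4-6) by (intro continuous_intros)
  have cBE: "continuous_on UNIV (\<lambda>p. catB a (fst p) * ?E p)"
    by (intro continuous_on_mult cE continuous_on_catB_fst[OF a])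
  have sq: "continuous_on UNIV (\<lambda>p. (g p)\<^sup>2)" using G(4) by (intro continuous_intros)
  have bdry: "\<rho> * bdry_integral a (\<lambda>p. (g p)\<^sup>2) = catB a \<rho> *
      (LINT t:{0..2 * pi}|lborel. \<rho> * (g (\<rho>, t))\<^sup>2 - (- \<rho>) * (g (- \<rho>, t))\<^sup>2)"
    using continuous_circle(2)[OF sq] by (simp add: bdry_integral_eq \<rho>_def set_integral_add algebra_simps)
  have "(LINT t:{0..2 * pi}|lborel. \<rho> * (g (\<rho>, t))\<^sup>2 - (- \<rho>) * (g (- \<rho>, t))\<^sup>2)
      = (LINT p:cell a|lborel. ?F' p)"
    unfolding \<rho>_def
  proof (subst cell_integral_deriv_s[OF a, where F = "\<lambda>p. fst p * (g p)\<^sup>2"])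
    show "((\<lambda>s. fst (s, t) * (g (s, t))\<^sup>2) has_real_derivative
        (g (s, t))\<^sup>2 + 2 * fst (s, t) * g (s, t) * gs (s, t)) (at s)" for s t
      by (auto intro!: derivative_eq_intros G(2) simp: algebra_simps power2_eq_square)
  qed (use cF in simp_all)
  also have "\<dots> \<le> (LINT p:cell a|lborel. (1 + \<rho>) / catB a 0 * (catB a (fst p) * ?E p))"
  proof (rule set_integral_mono)
    show "set_integrable lborel (cell a) ?F'"
      by (intro set_integrable_cell[OF a] cF)
    show "set_integrable lborel (cell a) (\<lambda>p. (1 + \<rho>) / catB a 0 * (catB a (fst p) * ?E p))"
      by (intro set_integrable_cell[OF a] continuous_on_mult continuous_on_const cBE)
    fix p assume p: "p \<in> cell a"
    then have s: "\<bar>fst p\<bar> \<le> \<rho>" by (auto simp: cell_def \<rho>_def)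
    have "2 * fst p * g p * gs p \<le> \<bar>fst p\<bar> * (2 * \<bar>g p\<bar> * \<bar>gs p\<bar>)"
      using abs_ge_self[of "2 * fst p * g p * gs p"] by (simp add: abs_mult mult_ac)
    also have "\<dots> \<le> \<rho> * ((g p)\<^sup>2 + (gs p)\<^sup>2)"
    proof (rule mult_mono[OF s])
      show "2 * \<bar>g p\<bar> * \<bar>gs p\<bar> \<le> (g p)\<^sup>2 + (gs p)\<^sup>2"
        using sum_squares_bound[of "\<bar>g p\<bar>" "\<bar>gs p\<bar>"] by simp
    qed (use \<rho> in auto)
    finally have "?F' p \<le> (1 + \<rho>) * ((g p)\<^sup>2 + (gs p)\<^sup>2)"
      by (simp add: algebra_simps add_increasing)
    also have "\<dots> \<le> (1 + \<rho>) * ?E p" using \<rho> by (intro mult_left_mono) auto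
    also have "\<dots> = (1 + \<rho>) / catB a 0 * (catB a 0 * ?E p)"
      using B[of 0] by (simp add: field_simps)
    also have "\<dots> \<le> (1 + \<rho>) / catB a 0 * (catB a (fst p) * ?E p)"
      using \<rho> B[of 0] catB_ge[OF a, of "fst p"]
      by (intro mult_left_mono mult_right_mono) auto
    finally show "?F' p \<le> (1 + \<rho>) / catB a 0 * (catB a (fst p) * ?E p)" .
  qed
  also have "\<dots> = (1 + \<rho>) / catB a 0 * (LINT p|area a. ?E p)"
    by (subst area_integral[OF a continuous_measurable_area[OF a cE]]) simp
  finally have le: "\<rho> * bdry_integral a (\<lambda>p. (g p)\<^sup>2) \<le> catB a \<rho> * ((1 + \<rho>) / catB a 0 * (LINT p|area a. ?E p))"
    unfolding bdry by (rule mult_left_mono) (simp add: B less_imp_le)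
  show "bdry_integral a (\<lambda>p. (g p)\<^sup>2) \<le> catB a \<rho> * (1 + \<rho>) / (catB a 0 * \<rho>) * (LINT p|area a. ?E p)"
    using divide_right_mono[OF le, of \<rho>] \<rho> by (simp add: mult_ac)
qed

context
  fixes u :: "real^4 \<Rightarrow> real" and Us Ut :: "real \<times> real \<Rightarrow> real"
  assumes u: "C1_cyl (u \<circ> Phi a) Us Ut"
begin

lemma C1_in_H1: "u \<in> H1 a"
  unfolding H1_def using C1_weak_derivs[OF a u] continuous_L2[OF a C1_cylD(4)[OF u]] by blast

lemma wderiv_props:
  "AE p in area a. wderiv_s a u p = Us p" "AE p in area a. wderiv_t a u p = Ut p"
  "wderiv_s a u \<in> borel_measurable (area a)" "wderiv_t a u \<in> borel_measurable (area a)"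
proof -
  have ex: "\<exists>x. case x of (V, W) \<Rightarrow> weak_derivs a (u \<circ> Phi a) V W"
    using C1_weak_derivs[OF a u] by auto
  have w: "weak_derivs a (u \<circ> Phi a) (wderiv_s a u) (wderiv_t a u)"
    using someI_ex[OF ex] unfolding wderiv_s_def wderiv_t_def wderiv_def by (simp add: case_prod_unfold)
  show "AE p in area a. wderiv_s a u p = Us p" "AE p in area a. wderiv_t a u p = Ut p"
    using weak_derivs_unique[OF a w C1_weak_derivs[OF a u]] by simp_all
  show "wderiv_s a u \<in> borel_measurable (area a)" "wderiv_t a u \<in> borel_measurable (area a)"
    using w by (simp_all add: weak_derivs_def L2_def)
qed

lemma H1_distance_eq:
  assumes f: "C1_cyl f fs ft"
  shows "(LINT p|area a. (f p - u (Phi a p))\<^sup>2 + (fs p - wderiv_s a u p)\<^sup>2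
            + (ft p - wderiv_t a u p)\<^sup>2 / (catB a (fst p))\<^sup>2)
       = (LINT p|area a. (f p - (u \<circ> Phi a) p)\<^sup>2 + (fs p - Us p)\<^sup>2
            + (ft p - Ut p)\<^sup>2 / (catB a (fst p))\<^sup>2)"
proof (rule integral_cong_AE)
  note [measurable] = continuous_measurable_area[OF a C1_cylD(4)[OF f]]
    continuous_measurable_area[OF a C1_cylD(5)[OF f]] continuous_measurable_area[OF a C1_cylD(6)[OF f]]
    continuous_measurable_area[OF a C1_cylD(4)[OF u, unfolded comp_def]]
    continuous_measurable_area[OF a C1_cylD(5)[OF u]] continuous_measurable_area[OF a C1_cylD(6)[OF u]]
    wderiv_props(3,4) continuous_measurable_area[OF a continuous_on_catB_fst[OF a]]
  show "(\<lambda>p. (f p - u (Phi a p))\<^sup>2 + (fs p - wderiv_s a u p)\<^sup>2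
            + (ft p - wderiv_t a u p)\<^sup>2 / (catB a (fst p))\<^sup>2) \<in> borel_measurable (area a)"
    by measurable
  show "(\<lambda>p. (f p - (u \<circ> Phi a) p)\<^sup>2 + (fs p - Us p)\<^sup>2
            + (ft p - Ut p)\<^sup>2 / (catB a (fst p))\<^sup>2) \<in> borel_measurable (area a)"
    unfolding comp_def by measurable
  show "AE p in area a. (f p - u (Phi a p))\<^sup>2 + (fs p - wderiv_s a u p)\<^sup>2
            + (ft p - wderiv_t a u p)\<^sup>2 / (catB a (fst p))\<^sup>2 =
      (f p - (u \<circ> Phi a) p)\<^sup>2 + (fs p - Us p)\<^sup>2 + (ft p - Ut p)\<^sup>2 / (catB a (fst p))\<^sup>2"
    using wderiv_props(1,2) by eventually_elim simp
qed

text \<open>The constant sequence of approximants does it.\<close>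

lemma is_trace_boundary_values: "is_trace a u (u \<circ> Phi a)"
  unfolding is_trace_def
  using u continuous_L2_bdry[OF C1_cylD(4)[OF u]] H1_distance_eq[OF u]
  by (intro conjI exI[of _ "\<lambda>_. u \<circ> Phi a"] exI[of _ "\<lambda>_. Us"] exI[of _ "\<lambda>_. Ut"])
    (auto simp: bdry_integral_eq set_lebesgue_integral_def)

text \<open>The approximants \<open>f n\<close> converge on the boundary to \<open>T\<close> by definition, and to the boundary values
  of \<open>u\<close> by the trace inequality applied to \<open>f n - u\<close>.\<close>

lemma trace_unique:
  assumes T: "is_trace a u T" and \<sigma>: "\<sigma> \<in> {- cat_s0 a, cat_s0 a}"
  shows "AE t in lborel. t \<in> {0..2 * pi} \<longrightarrow> T (\<sigma>, t) = u (Phi a (\<sigma>, t))"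
proof -
  let ?U = "u \<circ> Phi a"
  obtain f fs ft where TL: "L2_bdry a T" and f: "\<And>n. C1_cyl (f n) (fs n) (ft n)"
    and D: "(\<lambda>n::nat. LINT p|area a. (f n p - u (Phi a p))\<^sup>2 + (fs n p - wderiv_s a u p)\<^sup>2
            + (ft n p - wderiv_t a u p)\<^sup>2 / (catB a (fst p))\<^sup>2) \<longlonglongrightarrow> 0"
    and b: "(\<lambda>n. bdry_integral a (\<lambda>p. (f n p - T p)\<^sup>2)) \<longlonglongrightarrow> 0"
    using T unfolding is_trace_def by blast
  obtain C where C: "\<And>g gs gt. C1_cyl g gs gt \<Longrightarrow> bdry_integral a (\<lambda>p. (g p)\<^sup>2) \<le>
    C * (LINT p|area a. (g p)\<^sup>2 + (gs p)\<^sup>2 + (gt p)\<^sup>2 / (catB a (fst p))\<^sup>2)"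
    by (rule trace_inequality) blast
  note fU = C1_cyl_diff[OF f u]
  define e where "e = (\<lambda>n. C * (LINT p|area a. (f n p - ?U p)\<^sup>2 + (fs n p - Us p)\<^sup>2
            + (ft n p - Ut p)\<^sup>2 / (catB a (fst p))\<^sup>2))"
  have e: "e \<longlonglongrightarrow> C * 0"
    unfolding e_def using D unfolding H1_distance_eq[OF f] by (intro tendsto_intros)
  have Tsq: "set_integrable lborel {0..2 * pi} (\<lambda>t. (c (\<tau>, t) - T (\<tau>, t))\<^sup>2)"
    if "\<tau> \<in> {- cat_s0 a, cat_s0 a}" "continuous_on UNIV c" for c \<tau>
    using TL that unfolding L2_bdry_def by (intro square_integrable_diff continuous_circle(1)) auto
  have cf: "continuous_on UNIV (\<lambda>p. (f n p - ?U p)\<^sup>2)" for n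
    by (intro continuous_on_power C1_cylD(4)[OF fU])
  have ineq: "bdry_integral a (\<lambda>p. (?U p - T p)\<^sup>2) \<le> 2 * e n + 2 * bdry_integral a (\<lambda>p. (f n p - T p)\<^sup>2)" for n
  proof -
    have "bdry_integral a (\<lambda>p. (?U p - T p)\<^sup>2) \<le>
        bdry_integral a (\<lambda>p. 2 * (f n p - ?U p)\<^sup>2 + 2 * (f n p - T p)\<^sup>2)"
    proof (rule bdry_integral_mono)
      fix \<tau> assume \<tau>: "\<tau> \<in> {- cat_s0 a, cat_s0 a}"
      show "set_integrable lborel {0..2 * pi} (\<lambda>t. (?U (\<tau>, t) - T (\<tau>, t))\<^sup>2)"
        by (rule Tsq[OF \<tau> C1_cylD(4)[OF u]])
      show "set_integrable lborel {0..2 * pi} (\<lambda>t. 2 * (f n (\<tau>, t) - ?U (\<tau>, t))\<^sup>2 + 2 * (f n (\<tau>, t) - T (\<tau>, t))\<^sup>2)"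
        using Tsq[OF \<tau> C1_cylD(4)[OF f]] continuous_circle(2)[OF cf]
        by (intro set_integral_add set_integrable_mult_right)
    next
      fix p
      show "(?U p - T p)\<^sup>2 \<le> 2 * (f n p - ?U p)\<^sup>2 + 2 * (f n p - T p)\<^sup>2"
        using zero_le_power2[of "(f n p - ?U p) + (f n p - T p)"]
        by (simp add: power2_eq_square algebra_simps)
    qed
    also have "\<dots> = 2 * bdry_integral a (\<lambda>p. (f n p - ?U p)\<^sup>2) + 2 * bdry_integral a (\<lambda>p. (f n p - T p)\<^sup>2)"
      using Tsq[OF _ C1_cylD(4)[OF f]] continuous_circle(2)[OF cf]
      by (subst bdry_integral_add) (auto simp: bdry_integral_cmult)
    also have "bdry_integral a (\<lambda>p. (f n p - ?U p)\<^sup>2) \<le> e n"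
      unfolding e_def by (rule C[OF fU])
    finally show ?thesis by simp
  qed
  have "(\<lambda>n. 2 * e n + 2 * bdry_integral a (\<lambda>p. (f n p - T p)\<^sup>2)) \<longlonglongrightarrow> 2 * (C * 0) + 2 * 0"
    by (intro tendsto_intros e b)
  then have le: "bdry_integral a (\<lambda>p. (?U p - T p)\<^sup>2) \<le> 0"
    using ineq by (intro LIMSEQ_le_const) auto
  let ?I = "\<lambda>\<tau>. LINT t:{0..2 * pi}|lborel. (?U (\<tau>, t) - T (\<tau>, t))\<^sup>2"
  have nn: "0 \<le> ?I \<tau>" for \<tau> by (simp add: set_lebesgue_integral_def)
  have "?I (cat_s0 a) + ?I (- cat_s0 a) \<le> 0"
    using le cat_pos(2)[OF a, of "cat_s0 a"] by (simp add: bdry_integral_eq mult_le_0_iff)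
  then have "?I \<sigma> = 0" using nn[of "cat_s0 a"] nn[of "- cat_s0 a"] \<sigma> by auto
  then have "AE t in lborel. indicator {0..2 * pi} t *\<^sub>R (?U (\<sigma>, t) - T (\<sigma>, t))\<^sup>2 = 0"
    using Tsq[OF \<sigma> C1_cylD(4)[OF u]] unfolding set_lebesgue_integral_def set_integrable_def
    by (subst (asm) integral_nonneg_eq_0_iff_AE) auto
  then show ?thesis by eventually_elim (auto simp: indicator_def)
qed

lemma bdry_trace_props:
  assumes "\<sigma> \<in> {- cat_s0 a, cat_s0 a}"
  shows "AE t in lborel. t \<in> {0..2 * pi} \<longrightarrow> bdry_trace a u (\<sigma>, t) = u (Phi a (\<sigma>, t))"
    and "set_borel_measurable lborel {0..2 * pi} (\<lambda>t. bdry_trace a u (\<sigma>, t))"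
proof -
  have T: "is_trace a u (bdry_trace a u)"
    unfolding bdry_trace_def by (rule someI[of "is_trace a u", OF is_trace_boundary_values])
  show "AE t in lborel. t \<in> {0..2 * pi} \<longrightarrow> bdry_trace a u (\<sigma>, t) = u (Phi a (\<sigma>, t))"
    by (rule trace_unique[OF T assms])
  show "set_borel_measurable lborel {0..2 * pi} (\<lambda>t. bdry_trace a u (\<sigma>, t))"
    using T assms by (auto simp: is_trace_def L2_bdry_def)
qed

end

text \<open>The chosen weak derivatives and traces agree almost everywhere with the classical derivatives
  and boundary values, and the integrals do not see the difference.\<close>

lemma index_form_C1:
  assumes u: "C1_cyl (u \<circ> Phi a) Us Ut" and v: "C1_cyl (v \<circ> Phi a) Vs Vt"
  shows "index_form a u v =
    (LINT p:cell a|lborel. catB a (fst p) * ((Us p * Vs p + Ut p * Vt p / (catB a (fst p))\<^sup>2)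
        - (cat_II_sq a (fst p) - 2) * (u (Phi a p) * v (Phi a p))))
     - coth (cat_r a) * bdry_integral a (\<lambda>p. u (Phi a p) * v (Phi a p))"
proof -
  have B: "catB a s \<noteq> 0" for s using cat_pos(2)[OF a, of s] by simp
  have II: "continuous_on UNIV (\<lambda>p::real \<times> real. cat_II_sq a (fst p))"
    unfolding cat_II_sq_def using B by (intro continuous_intros continuous_on_catB_fst[OF a]) auto
  note cu = C1_cylD(4-6)[OF u, unfolded comp_def] and cv = C1_cylD(4-6)[OF v, unfolded comp_def]
  have c: "continuous_on UNIV (\<lambda>p. (Us p * Vs p + Ut p * Vt p / (catB a (fst p))\<^sup>2)
        - (cat_II_sq a (fst p) - 2) * (u (Phi a p) * v (Phi a p)))"
    using cu cv B by (intro continuous_intros II continuous_on_catB_fst[OF a]) auto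
  note [measurable] = cu[THEN continuous_measurable_area[OF a]] cv[THEN continuous_measurable_area[OF a]]
    II[THEN continuous_measurable_area[OF a]] continuous_on_catB_fst[OF a, THEN continuous_measurable_area[OF a]]
    wderiv_props(3,4)[OF u] wderiv_props(3,4)[OF v]
  have "(LINT p|area a.
        (wderiv_s a u p * wderiv_s a v p + wderiv_t a u p * wderiv_t a v p / (catB a (fst p))\<^sup>2)
        - (cat_II_sq a (fst p) - 2) * (u (Phi a p) * v (Phi a p))) =
     (LINT p|area a. (Us p * Vs p + Ut p * Vt p / (catB a (fst p))\<^sup>2)
        - (cat_II_sq a (fst p) - 2) * (u (Phi a p) * v (Phi a p)))"
  proof (rule integral_cong_AE)
    show "AE p in area a. (wderiv_s a u p * wderiv_s a v p + wderiv_t a u p * wderiv_t a v p / (catB a (fst p))\<^sup>2)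
        - (cat_II_sq a (fst p) - 2) * (u (Phi a p) * v (Phi a p)) =
      (Us p * Vs p + Ut p * Vt p / (catB a (fst p))\<^sup>2)
        - (cat_II_sq a (fst p) - 2) * (u (Phi a p) * v (Phi a p))"
      using wderiv_props(1,2)[OF u] wderiv_props(1,2)[OF v] by eventually_elim simp
  qed measurable
  moreover have "bdry_integral a (\<lambda>p. bdry_trace a u p * bdry_trace a v p) =
      bdry_integral a (\<lambda>p. u (Phi a p) * v (Phi a p))"
  proof (rule bdry_integral_cong_AE)
    fix \<sigma> assume \<sigma>: "\<sigma> \<in> {- cat_s0 a, cat_s0 a}"
    note pu = bdry_trace_props[OF u \<sigma>] and pv = bdry_trace_props[OF v \<sigma>]
    show "AE t in lborel. t \<in> {0..2 * pi} \<longrightarrow> bdry_trace a u (\<sigma>, t) * bdry_trace a v (\<sigma>, t) =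
        u (Phi a (\<sigma>, t)) * v (Phi a (\<sigma>, t))"
      using pu(1) pv(1) by eventually_elim simp
    have "(\<lambda>t. (indicator {0..2 * pi} t *\<^sub>R bdry_trace a u (\<sigma>, t)) *
        (indicator {0..2 * pi} t *\<^sub>R bdry_trace a v (\<sigma>, t))) \<in> borel_measurable lborel"
      using pu(2) pv(2) unfolding set_borel_measurable_def by measurable
    also have "(\<lambda>t. (indicator {0..2 * pi} t *\<^sub>R bdry_trace a u (\<sigma>, t)) *
        (indicator {0..2 * pi} t *\<^sub>R bdry_trace a v (\<sigma>, t))) =
      (\<lambda>t. indicator {0..2 * pi} t *\<^sub>R (bdry_trace a u (\<sigma>, t) * bdry_trace a v (\<sigma>, t)))"
      by (auto simp: indicator_def)
    finally show "set_borel_measurable lborel {0..2 * pi} (\<lambda>t. bdry_trace a u (\<sigma>, t) * bdry_trace a v (\<sigma>, t))"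
      by (simp add: set_borel_measurable_def)
    show "set_borel_measurable lborel {0..2 * pi} (\<lambda>t. u (Phi a (\<sigma>, t)) * v (Phi a (\<sigma>, t)))"
      using cu(1) cv(1) by (intro continuous_circle(3) continuous_on_mult)
  qed
  ultimately show ?thesis
    unfolding index_form_def by (simp add: area_integral[OF a continuous_measurable_area[OF a c]])
qed

end

section \<open>The span of the ambient coordinates\<close>

abbreviation ambient_comb :: "(4 \<Rightarrow> real) \<Rightarrow> real^4 \<Rightarrow> real" where
  "ambient_comb c \<equiv> \<lambda>x. \<Sum>i\<in>UNIV. c i * ambient_coord i x"

definition angular :: "(4 \<Rightarrow> real) \<Rightarrow> real \<Rightarrow> real" where
  "angular c t = c 2 * cos t + c 3 * sin t"

definition angular_t :: "(4 \<Rightarrow> real) \<Rightarrow> real \<Rightarrow> real" where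
  "angular_t c t = c 3 * cos t - c 2 * sin t"

lemma angular_deriv: "(angular c has_real_derivative angular_t c t) (at t)"
  and angular_t_deriv: "(angular_t c has_real_derivative - angular c t) (at t)"
  unfolding angular_def[abs_def] angular_t_def[abs_def]
  by (auto intro!: derivative_eq_intros)

lemma ambient_comb_Phi:
  "ambient_comb c (Phi a p) = axial a c (fst p) + catB a (fst p) * angular c (snd p)"
proof -
  have UNIV4: "sum f (UNIV :: 4 set) = f 0 + f 1 + f 2 + f 3" for f :: "4 \<Rightarrow> real"
  proof -
    have four: "(4 :: 4) = 0" by simp
    show ?thesis by (simp only: sum_4 four add_ac)
  qed
  show ?thesis
    by (cases p) (simp add: UNIV4 ambient_coord_def Phi_def axial_def angular_def algebra_simps)
qed

lemma ambient_coord_eq_comb: "ambient_coord i = ambient_comb (\<lambda>j. if j = i then 1 else 0)"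
  by (simp add: if_distrib[where f = "\<lambda>c. c * _"] cong: if_cong)

context
  fixes a :: real
  assumes a: "a > 1/2"
begin

lemma axial_continuous: "continuous_on X (axial a c)" "continuous_on X (axial_s a c)"
proof -
  show "continuous_on X (axial a c)"
    unfolding axial_def[abs_def] by (intro continuous_intros continuous_on_cat[OF a])
  have "catA a s \<noteq> 0" "catB a s \<noteq> 0" for s using cat_pos(1,2)[OF a, of s] by auto
  then show "continuous_on X (axial_s a c)"
    unfolding axial_s_def[abs_def] by (intro continuous_intros continuous_on_cat[OF a]) auto
qed

lemma angular_continuous: "continuous_on X (angular c)" "continuous_on X (angular_t c)"
  unfolding angular_def[abs_def] angular_t_def[abs_def] by (intro continuous_intros)+

lemma ambient_comb_C1:
  "C1_cyl (ambient_comb c \<circ> Phi a)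
     (\<lambda>p. axial_s a c (fst p) + a * sinh (2 * fst p) / catB a (fst p) * angular c (snd p))
     (\<lambda>p. catB a (fst p) * angular_t c (snd p))"
proof -
  have B: "catB a s \<noteq> 0" for s using cat_pos(2)[OF a, of s] by simp
  have c: "continuous_on UNIV (\<lambda>s. a * sinh (2 * s) / catB a s)"
    by (intro continuous_intros continuous_on_cat[OF a]) (simp add: B)
  have 1: "C1_cyl (\<lambda>p. axial a c (fst p) * 1) (\<lambda>p. axial_s a c (fst p) * 1) (\<lambda>p. axial a c (fst p) * 0)"
    by (rule C1_cyl_product[OF axial_deriv[OF a] axial_continuous(2), of "\<lambda>_. 1" "\<lambda>_. 0"]) auto
  have 2: "C1_cyl (\<lambda>p. catB a (fst p) * angular c (snd p))
      (\<lambda>p. a * sinh (2 * fst p) / catB a (fst p) * angular c (snd p))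
      (\<lambda>p. catB a (fst p) * angular_t c (snd p))"
    by (rule C1_cyl_product[OF catB_deriv[OF a] c angular_deriv angular_continuous(2)])
      (simp add: angular_def)
  show ?thesis
    using C1_cyl_add[OF 1 2] by (simp add: comp_def ambient_comb_Phi)
qed

lemma ambient_comb_continuous: "continuous_on UNIV (\<lambda>p. ambient_comb c (Phi a p))"
  using C1_cylD(4)[OF ambient_comb_C1] by (simp add: comp_def)

text \<open>The rotating part averages out over each circle, and \<open>\<Phi>\<^sup>1\<close> takes opposite values on the two.\<close>

lemma bdry_integral_ambient_comb:
  "bdry_integral a (\<lambda>p. ambient_comb c (Phi a p)) =
     4 * pi * catB a (cat_s0 a) * catA a (cat_s0 a) * cosh (cat_phi a (cat_s0 a)) * c 0"
proof -
  have i: "(LINT t:{0..2 * pi}|lborel. axial a c s + catB a s * angular c t) = 2 * pi * axial a c s" for s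
  proof -
    have "(LINT t:{0..2 * pi}|lborel. axial a c s + catB a s * angular c t) =
        (axial a c s * (2 * pi) - catB a s * angular_t c (2 * pi)) - (axial a c s * 0 - catB a s * angular_t c 0)"
    proof (rule interval_FTC)
      show "((\<lambda>t. axial a c s * t - catB a s * angular_t c t) has_real_derivative
          axial a c s + catB a s * angular c t) (at t)" for t
        by (auto intro!: derivative_eq_intros angular_t_deriv)
    qed (simp, intro continuous_intros angular_continuous)
    then show ?thesis by (simp add: angular_t_def)
  qed
  show ?thesis
    unfolding bdry_integral_eq[OF a] ambient_comb_Phi fst_conv snd_conv i
    by (simp add: axial_def catA_minus[OF a] cat_phi_minus[OF a] algebra_simps)
qed

text \<open>The coordinate functions satisfy \<open>\<Delta> v = 2 v\<close>: the flux \<open>B v\<^sub>s\<close> has \<open>s\<close>-derivative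
  \<open>2 B axial + 2 a cosh (2 s) angular\<close>, and \<open>2 a cosh (2 s) - 1 = 2 B\<^sup>2\<close>.  By Green's formula only
  the \<open>|II|\<^sup>2\<close> term and the failure of the Robin condition remain; the latter is a multiple of \<open>d 0\<close>
  times the integral of the first function over the boundary, which is a multiple of \<open>c 0\<close>.\<close>

lemma index_form_ambient_comb:
  "\<exists>\<kappa>>0. \<forall>c d. index_form a (ambient_comb c) (ambient_comb d) =
     - (LINT p:cell a|lborel. catB a (fst p) * cat_II_sq a (fst p) *
          (ambient_comb c (Phi a p) * ambient_comb d (Phi a p))) - \<kappa> * c 0 * d 0"
proof -
  define \<rho> where "\<rho> = cat_s0 a"
  define Q where "Q = coth (cat_r a)"
  obtain \<kappa> where \<kappa>: "\<kappa> > 0"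
    and robin: "\<And>c. axial_s a c \<rho> = Q * axial a c \<rho> - \<kappa> * c 0"
      "\<And>c. - axial_s a c (- \<rho>) = Q * axial a c (- \<rho>) - \<kappa> * c 0"
    using axial_robin[OF a] unfolding \<rho>_def Q_def by blast
  have B: "catB a s > 0" "catB a s \<noteq> 0" for s using cat_pos(2)[OF a, of s] by auto
  have SQ: "a * sinh (2 * \<rho>) = Q * catB a \<rho> * catB a \<rho>"
    using coth_cat_r[OF a] B[of \<rho>] by (simp add: Q_def \<rho>_def power2_eq_square field_simps)
  define \<mu> where "\<mu> = 4 * pi * catB a \<rho> * catA a \<rho> * cosh (cat_phi a \<rho>)"
  have \<mu>: "\<mu> > 0" using B cat_pos(1)[OF a] by (simp add: \<mu>_def)
  have "index_form a (ambient_comb c) (ambient_comb d) =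
     - (LINT p:cell a|lborel. catB a (fst p) * cat_II_sq a (fst p) *
          (ambient_comb c (Phi a p) * ambient_comb d (Phi a p))) - \<kappa> * \<mu> * c 0 * d 0" for c d
  proof -
    define u where "u = (\<lambda>p. ambient_comb c (Phi a p))"
    define v where "v = (\<lambda>p. ambient_comb d (Phi a p))"
    define us where "us = (\<lambda>p. axial_s a c (fst p) + a * sinh (2 * fst p) / catB a (fst p) * angular c (snd p))"
    define ut where "ut = (\<lambda>p. catB a (fst p) * angular_t c (snd p))"
    define vs where "vs = (\<lambda>p. axial_s a d (fst p) + a * sinh (2 * fst p) / catB a (fst p) * angular d (snd p))"
    define vt where "vt = (\<lambda>p. catB a (fst p) * angular_t d (snd p))"
    have u: "C1_cyl u us ut" and v: "C1_cyl v vs vt"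
      using ambient_comb_C1 by (simp_all add: u_def v_def us_def ut_def vs_def vt_def comp_def)
    note U = C1_cylD[OF u] and V = C1_cylD[OF v]
    have vp: "v p = axial a d (fst p) + catB a (fst p) * angular d (snd p)" for p
      by (simp add: v_def ambient_comb_Phi)
    define G where "G = (\<lambda>p. catB a (fst p) * axial_s a d (fst p) + a * sinh (2 * fst p) * angular d (snd p))"
    define Gs where "Gs = (\<lambda>p. 2 * catB a (fst p) * axial a d (fst p) + 2 * a * cosh (2 * fst p) * angular d (snd p))"
    (* F' is the s-derivative of u B v_s, and H' the theta-derivative of u v_t / B *)
    define F' where "F' = (\<lambda>p. us p * G p + u p * Gs p)"
    define H' where "H' = (\<lambda>p. ut p * angular_t d (snd p) - u p * angular d (snd p))"
    define W where "W = (\<lambda>p. catB a (fst p) * cat_II_sq a (fst p) * (u p * v p))"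
    have G_eq: "G p = catB a (fst p) * vs p" for p
      using B by (simp add: G_def vs_def field_simps)
    have snd_c: "continuous_on UNIV (\<lambda>p. f (snd p))" if "continuous_on UNIV f" for f :: "real \<Rightarrow> real"
      by (rule continuous_on_compose2[OF that]) (auto intro: continuous_on_snd continuous_on_id)
    have fst_c: "continuous_on UNIV (\<lambda>p. f (fst p))" if "continuous_on UNIV f" for f :: "real \<Rightarrow> real"
      by (rule continuous_on_compose2[OF that]) (auto intro: continuous_on_fst continuous_on_id)
    note ci = continuous_on_catB_fst[OF a] fst_c[OF axial_continuous(1)] fst_c[OF axial_continuous(2)]
      snd_c[OF angular_continuous(1)] snd_c[OF angular_continuous(2)] U(4-6) V(4-6)
    have cG: "continuous_on UNIV G" "continuous_on UNIV Gs"
      unfolding G_def Gs_def by (intro continuous_intros ci)+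
    have cF: "continuous_on UNIV F'" and cH: "continuous_on UNIV H'"
      unfolding F'_def H'_def by (intro continuous_intros ci cG)+
    have cW: "continuous_on UNIV W"
      unfolding W_def cat_II_sq_def by (intro continuous_intros ci) (simp add: B)
    have dG: "((\<lambda>s. G (s, t)) has_real_derivative Gs (s, t)) (at s)" for s t
      unfolding G_def Gs_def fst_conv snd_conv
      by (rule DERIV_add[OF axial_flux_deriv[OF a]]) (auto intro!: derivative_eq_intros)
    have intF: "(LINT p:cell a|lborel. F' p) =
        (LINT t:{0..2 * pi}|lborel. u (\<rho>, t) * G (\<rho>, t) - u (- \<rho>, t) * G (- \<rho>, t))"
      unfolding \<rho>_def
      by (rule cell_integral_deriv_s[OF a, where F = "\<lambda>p. u p * G p"])
        (use DERIV_mult[OF U(2) dG] cF in \<open>simp_all add: F'_def algebra_simps\<close>)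
    have intH: "(LINT p:cell a|lborel. H' p) = 0"
    proof (rule cell_integral_deriv_t[OF a, where F = "\<lambda>p. u p * angular_t d (snd p)"])
      show "((\<lambda>t. u (s, t) * angular_t d (snd (s, t))) has_real_derivative H' (s, t)) (at t)" for s t
        using DERIV_mult[OF U(3) angular_t_deriv] by (simp add: H'_def algebra_simps)
      show "u (s, t + 2 * pi) * angular_t d (snd (s, t + 2 * pi)) = u (s, t) * angular_t d (snd (s, t))" for s t
        using U(1) by (simp add: angular_t_def)
    qed (rule cH)
    have integrand: "catB a (fst p) * ((us p * vs p + ut p * vt p / (catB a (fst p))\<^sup>2)
        - (cat_II_sq a (fst p) - 2) * (u p * v p)) = F' p + H' p - W p" for p
    proof -
      have BB: "2 * a * cosh (2 * fst p) = 2 * catB a (fst p) * catB a (fst p) + 1"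
        using cat_pos(5)[OF a, of "fst p"] by (simp add: power2_eq_square algebra_simps)
      have "Gs p - angular d (snd p) = 2 * catB a (fst p) * v p"
        unfolding Gs_def BB vp by (simp add: algebra_simps)
      then have "F' p + H' p = catB a (fst p) * us p * vs p + ut p * angular_t d (snd p) + 2 * catB a (fst p) * (u p * v p)"
        unfolding F'_def H'_def G_eq by (simp add: algebra_simps)
      moreover have "catB a (fst p) * (ut p * vt p / (catB a (fst p))\<^sup>2) = ut p * angular_t d (snd p)"
        using B by (simp add: vt_def power2_eq_square)
      ultimately show ?thesis by (simp add: W_def algebra_simps)
    qed
    have G_bdry: "G (\<rho>, t) = catB a \<rho> * (Q * v (\<rho>, t) - \<kappa> * d 0)"
      "- G (- \<rho>, t) = catB a \<rho> * (Q * v (- \<rho>, t) - \<kappa> * d 0)" for t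
      using robin(2)[of d] unfolding G_def vp fst_conv snd_conv mult_minus_right sinh_minus SQ robin(1)
      by (simp_all add: algebra_simps catB_minus[OF a] SQ)
    let ?K = "\<lambda>p. Q * (u p * v p) + (- \<kappa> * d 0) * u p"
    have iK: "set_integrable lborel {0..2 * pi} (\<lambda>t. ?K (\<sigma>, t))" for \<sigma>
      by (intro continuous_circle(2) continuous_intros ci)
    have "(LINT p:cell a|lborel. F' p) = (LINT t:{0..2 * pi}|lborel. catB a \<rho> * (?K (\<rho>, t) + ?K (- \<rho>, t)))"
    proof -
      have "u (\<rho>, t) * G (\<rho>, t) - u (- \<rho>, t) * G (- \<rho>, t) = catB a \<rho> * (?K (\<rho>, t) + ?K (- \<rho>, t))" for t
      proof -
        have "u (\<rho>, t) * G (\<rho>, t) - u (- \<rho>, t) * G (- \<rho>, t) =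
            u (\<rho>, t) * G (\<rho>, t) + u (- \<rho>, t) * (- G (- \<rho>, t))" by simp
        also have "\<dots> = catB a \<rho> * (?K (\<rho>, t) + ?K (- \<rho>, t))"
          unfolding G_bdry by (simp add: algebra_simps)
        finally show ?thesis .
      qed
      then show ?thesis using intF by simp
    qed
    also have "\<dots> = bdry_integral a ?K"
      unfolding bdry_integral_eq[OF a] \<rho>_def[symmetric] set_integral_add(2)[OF iK iK, symmetric]
      by (rule set_integral_mult_right)
    also have "\<dots> = Q * bdry_integral a (\<lambda>p. u p * v p) + (- \<kappa> * d 0) * bdry_integral a u"
      by (subst bdry_integral_add[OF a], (intro continuous_circle(2) continuous_intros ci)+)
        (simp only: bdry_integral_cmult[OF a])
    also have "bdry_integral a u = \<mu> * c 0"
      unfolding u_def bdry_integral_ambient_comb \<mu>_def \<rho>_def ..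
    finally have iF: "(LINT p:cell a|lborel. F' p) =
        Q * bdry_integral a (\<lambda>p. u p * v p) - \<kappa> * \<mu> * c 0 * d 0" by simp
    have "C1_cyl (ambient_comb c \<circ> Phi a) us ut" "C1_cyl (ambient_comb d \<circ> Phi a) vs vt"
      unfolding us_def ut_def vs_def vt_def by (rule ambient_comb_C1)+
    moreover have "ambient_comb c (Phi a p) = u p" "ambient_comb d (Phi a p) = v p" for p
      by (simp_all add: u_def v_def)
    ultimately have "index_form a (ambient_comb c) (ambient_comb d) =
        (LINT p:cell a|lborel. F' p + H' p - W p) - Q * bdry_integral a (\<lambda>p. u p * v p)"
      using index_form_C1[OF a, of "ambient_comb c" us ut "ambient_comb d" vs vt]
      by (simp only: integrand Q_def)
    also have "(LINT p:cell a|lborel. F' p + H' p - W p) =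
        (LINT p:cell a|lborel. F' p) + (LINT p:cell a|lborel. H' p) - (LINT p:cell a|lborel. W p)"
      by (simp add: set_integral_add set_integral_diff set_integrable_cell[OF a] cF cH cW)
    finally show ?thesis unfolding iF intH by (simp add: W_def u_def v_def)
  qed
  then show ?thesis using \<kappa> \<mu> by (intro exI[of _ "\<kappa> * \<mu>"]) simp
qed


section \<open>Negativity, independence and orthogonality of the coordinates\<close>

text \<open>The form equals \<open>- \<integral> |II|\<^sup>2 u\<^sup>2 dA - \<kappa> c\<^sub>0\<^sup>2\<close>, and the catenoid has no umbilic points: \<open>|II|\<^sup>2 > 0\<close>
  everywhere.\<close>

lemma ambient_comb_negative:
  assumes nz: "\<not> ae_zero a (ambient_comb c)"
  shows "index_form a (ambient_comb c) (ambient_comb c) < 0"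
proof -
  let ?u = "\<lambda>p. ambient_comb c (Phi a p)"
  obtain \<kappa> where \<kappa>: "\<kappa> > 0" and form: "index_form a (ambient_comb c) (ambient_comb c) =
     - (LINT p:cell a|lborel. catB a (fst p) * cat_II_sq a (fst p) * (?u p * ?u p)) - \<kappa> * c 0 * c 0"
    using index_form_ambient_comb by blast
  have B: "catB a s > 0" "catB a s \<noteq> 0" for s using cat_pos(2)[OF a, of s] by auto
  have II: "cat_II_sq a s > 0" for s
    using B[of s] cat_pos(3)[OF a] by (simp add: cat_II_sq_def)
  have c: "continuous_on UNIV (\<lambda>p. cat_II_sq a (fst p) * (?u p * ?u p))"
    unfolding cat_II_sq_def
    by (intro continuous_intros continuous_on_catB_fst[OF a] ambient_comb_continuous) (simp add: B)
  have "(LINT p:cell a|lborel. catB a (fst p) * cat_II_sq a (fst p) * (?u p * ?u p)) =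
      (LINT p|area a. cat_II_sq a (fst p) * (?u p * ?u p))"
    by (subst area_integral[OF a continuous_measurable_area[OF a c]]) (simp add: mult.assoc)
  moreover have "(LINT p|area a. cat_II_sq a (fst p) * (?u p * ?u p)) > 0"
  proof -
    have nn: "AE p in area a. 0 \<le> cat_II_sq a (fst p) * (?u p * ?u p)"
      by (intro AE_I2 mult_nonneg_nonneg[OF less_imp_le[OF II] zero_le_square])
    have "(LINT p|area a. cat_II_sq a (fst p) * (?u p * ?u p)) \<noteq> 0"
    proof
      assume "(LINT p|area a. cat_II_sq a (fst p) * (?u p * ?u p)) = 0"
      then have "AE p in area a. cat_II_sq a (fst p) * (?u p * ?u p) = 0"
        using integral_nonneg_eq_0_iff_AE[OF continuous_integrable_area[OF a c] nn] by simp
      then have "AE p in area a. ?u p = 0"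
        by eventually_elim (use II in \<open>auto simp: less_imp_neq[symmetric]\<close>)
      then show False using nz by (simp add: ae_zero_def)
    qed
    then show ?thesis using integral_nonneg_AE[OF nn] by simp
  qed
  moreover have "0 \<le> \<kappa> * c 0 * c 0" using \<kappa> by (simp add: mult.assoc)
  ultimately show ?thesis using form by simp
qed

lemma ambient_coord_in_H1: "ambient_coord i \<in> H1 a"
  unfolding ambient_coord_eq_comb[of i] by (rule C1_in_H1[OF a ambient_comb_C1])

text \<open>A continuous function that vanishes almost everywhere vanishes in the interior.  At
  \<open>s = 0\<close> the hyperbolic sine drops out, and three angles determine \<open>c 0\<close>, \<open>c 2\<close>, \<open>c 3\<close>; any
  other \<open>s\<close> gives \<open>c 1\<close>.\<close>

lemma ambient_comb_ae_zero_imp: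
  assumes "ae_zero a (ambient_comb c)"
  shows "c = (\<lambda>_. 0)"
proof -
  let ?u = "\<lambda>p. ambient_comb c (Phi a p)"
  let ?O = "box (- cat_s0 a, 0) (cat_s0 a, 2 * pi) :: (real \<times> real) set"
  define N where "N = ?O \<inter> {p. ?u p \<noteq> 0}"
  have "open {p. ?u p \<noteq> 0}"
    by (intro open_Collect_neq ambient_comb_continuous continuous_on_const)
  then have N: "open N" unfolding N_def by (intro open_Int open_box)
  have "AE p in lborel. p \<in> cell a \<longrightarrow> ?u p = 0"
    using assms by (simp add: ae_zero_def AE_area[OF a])
  then have "AE p in lborel. p \<notin> N"
    by eventually_elim (auto simp: N_def cell_def box_prod)
  then have "N \<in> null_sets lborel"
    using N by (subst AE_iff_null_sets) auto
  then have "negligible N"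
    by (simp add: negligible_iff_null_sets null_sets_completionI)
  then have "N = {}" using open_not_negligible[OF N] by blast
  then have z: "axial a c s + catB a s * angular c t = 0" if "\<bar>s\<bar> < cat_s0 a" "0 < t" "t < 2 * pi" for s t
  proof -
    have "(s, t) \<in> ?O" using that by (simp add: box_prod abs_less_iff)
    with \<open>N = {}\<close> have "?u (s, t) = 0" unfolding N_def by blast
    then show ?thesis by (simp add: ambient_comb_Phi)
  qed
  have s0: "cat_s0 a > 0" by (rule cat_s0_props(1)[OF a])
  have A: "catA a s > 0" and B: "catB a s > 0" for s using cat_pos(1,2)[OF a] by auto
  have e: "catA a 0 * c 0 + catB a 0 * angular c t = 0" if "0 < t" "t < 2 * pi" for t
    using z[of 0 t] that s0 by (simp add: axial_def cat_phi_0[OF a])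
  have "catA a 0 * c 0 + catB a 0 * c 3 = 0" "catA a 0 * c 0 - catB a 0 * c 2 = 0"
    using e[of "pi / 2"] e[of pi] by (simp_all add: angular_def)
  moreover have "catA a 0 * c 0 - catB a 0 * c 3 = 0"
  proof -
    have "cos (3 * pi / 2) = 0" "sin (3 * pi / 2) = -1"
      using sin_3over2_pi cos_3over2_pi by (simp_all add: mult.commute)
    then show ?thesis using e[of "3 * pi / 2"] by (simp add: angular_def)
  qed
  ultimately have c023: "c 0 = 0" "c 2 = 0" "c 3 = 0"
    using A[of 0] B[of 0] by auto
  have "cat_phi a (cat_s0 a / 2) > 0"
    using cat_phi_strict_mono[OF a, of 0 "cat_s0 a / 2"] s0 by (simp add: cat_phi_0[OF a])
  then have "c 1 = 0"
    using z[of "cat_s0 a / 2" pi] s0 A[of "cat_s0 a / 2"] c023 by (simp add: axial_def angular_def)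
  moreover have "i = 0 \<or> i = 1 \<or> i = 2 \<or> i = 3" for i :: 4
    using exhaust_4[of i] by auto
  ultimately show ?thesis using c023 by (metis (full_types) ext)
qed

text \<open>The coordinates are products of a function of \<open>s\<close> and a function of \<open>\<theta>\<close>.  Different
  coordinates are orthogonal in \<open>\<theta>\<close>, except for the pair \<open>\<Phi>\<^sup>0, \<Phi>\<^sup>1\<close>, whose product is odd in \<open>s\<close>.\<close>

lemma ambient_coord_orthogonal:
  fixes i j :: 4
  assumes ij: "i \<noteq> j" and w: "continuous_on UNIV w" "\<And>s. w (- s) = w s"
  shows "(LINT p:cell a|lborel. w (fst p) * (ambient_coord i (Phi a p) * ambient_coord j (Phi a p))) = 0"
proof -
  define f where "f = (\<lambda>i::4. \<lambda>s. if i = 0 then catA a s * cosh (cat_phi a s)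
    else if i = 1 then catA a s * sinh (cat_phi a s) else catB a s)"
  define g where "g = (\<lambda>i::4. \<lambda>t::real. if i = 2 then cos t else if i = 3 then sin t else 1)"
  have four: "i = 0 \<or> i = 1 \<or> i = 2 \<or> i = 3" for i :: 4
    using exhaust_4[of i] by auto
  have fg: "ambient_coord i (Phi a p) = f i (fst p) * g i (snd p)" for i p
    using four[of i] by (cases p) (auto simp: ambient_coord_def Phi_def f_def g_def)
  have cf: "continuous_on X (f i)" for i X
    by (cases "i = 0"; cases "i = 1"; simp add: f_def;
      intro continuous_on_mult continuous_on_cosh continuous_on_sinh continuous_on_cat[OF a])
  have cg: "continuous_on X (g i)" for i X
    by (cases "i = 2"; cases "i = 3"; simp add: g_def;
      intro continuous_on_cos continuous_on_sin continuous_on_id continuous_on_const)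
  have c: "continuous_on UNIV (\<lambda>p::real \<times> real. w (fst p) * (f i (fst p) * g i (snd p) * (f j (fst p) * g j (snd p))))"
    by (intro continuous_on_mult continuous_on_compose2[OF w(1)] continuous_on_compose2[OF cf[of UNIV]]
        continuous_on_compose2[OF cg[of UNIV]] continuous_on_fst continuous_on_snd continuous_on_id subset_UNIV)
  let ?S = "LINT s:{- cat_s0 a..cat_s0 a}|lborel. w s * f i s * f j s"
  let ?T = "LINT t:{0..2 * pi}|lborel. g i t * g j t"
  have "(LINT p:cell a|lborel. w (fst p) * (ambient_coord i (Phi a p) * ambient_coord j (Phi a p))) =
      (LINT s:{- cat_s0 a..cat_s0 a}|lborel. LINT t:{0..2 * pi}|lborel. (w s * f i s * f j s) * (g i t * g j t))"
    unfolding fg cell_def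
    by (subst rectangle_integral(1)[OF continuous_on_subset[OF c]]) (simp_all add: mult_ac)
  also have "\<dots> = ?S * ?T" by simp
  also have "?S * ?T = 0"
  proof (cases "i \<in> {0, 1} \<and> j \<in> {0, 1}")
    case True
    have "w (- s) * f i (- s) * f j (- s) = - (w s * f i s * f j s)" for s
      using True ij w(2) by (auto simp: f_def catA_minus[OF a] cat_phi_minus[OF a])
    then have "?S = - ?S"
      using lborel_integral_real_affine[of "-1" "\<lambda>s. indicator {- cat_s0 a..cat_s0 a} s * (w s * f i s * f j s)" 0]
      by (simp add: set_lebesgue_integral_def indicator_def minus_le_iff conj_commute)
    then show ?thesis by simp
  next
    case False
    have cs: "(LINT t:{0..2 * pi}|lborel. cos t) = 0"
      using interval_FTC[of 0 "2 * pi" sin cos, OF _ DERIV_sin continuous_on_cos_real] by simp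
    have sn: "(LINT t:{0..2 * pi}|lborel. sin t) = 0"
    proof -
      have "((\<lambda>t. - cos t) has_real_derivative sin t) (at t)" for t :: real
        by (auto intro!: derivative_eq_intros)
      from interval_FTC[of 0 "2 * pi" "\<lambda>t. - cos t" sin, OF _ this continuous_on_sin_real]
      show ?thesis by simp
    qed
    have sc: "(LINT t:{0..2 * pi}|lborel. sin t * cos t) = 0"
    proof -
      have "((\<lambda>t. (sin t)\<^sup>2 / 2) has_real_derivative sin t * cos t) (at t)" for t :: real
        by (auto intro!: derivative_eq_intros)
      from interval_FTC[of 0 "2 * pi" "\<lambda>t. (sin t)\<^sup>2 / 2" "\<lambda>t. sin t * cos t", OF _ this
          continuous_on_mult[OF continuous_on_sin_real continuous_on_cos_real]]
      show ?thesis by simp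
    qed
    have "?T = 0"
      using four[of i] four[of j] False ij cs sn sc by (auto simp: g_def mult.commute)
    then show ?thesis by simp
  qed
  finally show ?thesis .
qed

lemma ambient_coord_index_form_diagonal:
  assumes "i \<noteq> j"
  shows "index_form a (ambient_coord i) (ambient_coord j) = 0"
proof -
  let ?\<delta> = "\<lambda>i k :: 4. if k = i then 1 else 0 :: real"
  obtain \<kappa> where form: "\<And>c d. index_form a (ambient_comb c) (ambient_comb d) =
     - (LINT p:cell a|lborel. catB a (fst p) * cat_II_sq a (fst p) *
          (ambient_comb c (Phi a p) * ambient_comb d (Phi a p))) - \<kappa> * c 0 * d 0"
    using index_form_ambient_comb by blast
  have B: "catB a s \<noteq> 0" for s using cat_pos(2)[OF a, of s] by simp
  have "(LINT p:cell a|lborel. catB a (fst p) * cat_II_sq a (fst p) *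
          (ambient_coord i (Phi a p) * ambient_coord j (Phi a p))) = 0"
  proof (rule ambient_coord_orthogonal[OF assms, where w = "\<lambda>s. catB a s * cat_II_sq a s"])
    show "continuous_on UNIV (\<lambda>s. catB a s * cat_II_sq a s)"
      unfolding cat_II_sq_def by (intro continuous_intros continuous_on_cat[OF a]) (simp add: B)
  qed (simp add: cat_II_sq_def catB_minus[OF a])
  moreover have \<delta>: "(\<Sum>l\<in>UNIV. ?\<delta> k l * ambient_coord l x) = ambient_coord k x" for k x
    by (rule fun_cong[OF ambient_coord_eq_comb, symmetric])
  ultimately show ?thesis
    using form[of "?\<delta> i" "?\<delta> j"] assms unfolding \<delta> by auto
qed

end

text \<open>The Morse index asks for families indexed by an initial segment of the natural numbers, while the
  coordinates are indexed by the type \<open>4\<close>.  A bijection of the index sets changes neither the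
  combinations of a family nor the vanishing of their coefficients.\<close>

lemma sum_reindex_family:
  fixes f :: "'j \<Rightarrow> real^4 \<Rightarrow> real"
  assumes "bij_betw h I J"
  shows "(\<lambda>x. \<Sum>i\<in>I. c i * f (h i) x) = (\<lambda>x. \<Sum>j\<in>J. c (the_inv_into I h j) * f j x)"
proof
  fix x
  show "(\<Sum>i\<in>I. c i * f (h i) x) = (\<Sum>j\<in>J. c (the_inv_into I h j) * f j x)"
    using assms by (subst sum.reindex_bij_betw[OF assms, symmetric])
      (auto intro!: sum.cong simp: the_inv_into_f_f bij_betw_def)
qed

lemma lin_indep_H1_reindex:
  assumes h: "bij_betw h I J" and f: "lin_indep_H1 a J f"
  shows "lin_indep_H1 a I (\<lambda>i. f (h i))"
  unfolding lin_indep_H1_def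
proof (intro conjI ballI allI impI)
  show "f (h i) \<in> H1 a" if "i \<in> I" for i
    using f h that by (auto simp: lin_indep_H1_def bij_betw_def)
  have indep: "ae_zero a (\<lambda>x. \<Sum>j\<in>J. d j * f j x) \<Longrightarrow> \<forall>j\<in>J. d j = 0" for d
    using f unfolding lin_indep_H1_def by simp
  fix c i assume "ae_zero a (\<lambda>x. \<Sum>i\<in>I. c i * f (h i) x)" and i: "i \<in> I"
  then have "\<forall>j\<in>J. c (the_inv_into I h j) = 0"
    using indep[of "\<lambda>j. c (the_inv_into I h j)"] unfolding sum_reindex_family[OF h] by simp
  then show "c i = 0"
    using h i by (metis bij_betw_def imageI the_inv_into_f_f)
qed

lemma neg_def_on_span_reindex:
  assumes h: "bij_betw h I J" and f: "neg_def_on_span a J f"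
  shows "neg_def_on_span a I (\<lambda>i. f (h i))"
  using f unfolding neg_def_on_span_def sum_reindex_family[OF h] by simp

lemma bij_betw_of_nat_4: "bij_betw (of_nat :: nat \<Rightarrow> 4) {..<4} UNIV"
proof -
  have "inj_on (of_nat :: nat \<Rightarrow> 4) {..<4}"
    by (auto simp: inj_on_def lessThan_nat_numeral lessThan_Suc numeral_eq_Suc)
  moreover have "(of_nat :: nat \<Rightarrow> 4) ` {..<4} = UNIV"
    using calculation by (intro card_subset_eq) (simp_all add: card_image)
  ultimately show ?thesis by (simp add: bij_betw_def)
qed

theorem theorem3:
  fixes a :: real
  assumes "a > 1/2"
  shows "morse_index a \<ge> 4 \<and>
         lin_indep_H1 a UNIV ambient_coord \<and>
         (\<forall>i j. i \<noteq> j \<longrightarrow> index_form a (ambient_coord i) (ambient_coord j) = 0) \<and>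
         neg_def_on_span a UNIV ambient_coord"
proof -
  have lin: "lin_indep_H1 a UNIV ambient_coord"
    unfolding lin_indep_H1_def
  proof (intro conjI ballI allI impI)
    show "c i = 0" if "ae_zero a (ambient_comb c)" for c i
      using ambient_comb_ae_zero_imp[OF assms that] by simp
  qed (rule ambient_coord_in_H1[OF assms])
  have neg: "neg_def_on_span a UNIV ambient_coord"
    unfolding neg_def_on_span_def Let_def using ambient_comb_negative[OF assms] by blast
  have "enat 4 \<le> morse_index a"
    unfolding morse_index_def
    using lin_indep_H1_reindex[OF bij_betw_of_nat_4 lin] neg_def_on_span_reindex[OF bij_betw_of_nat_4 neg]
    by (intro Sup_upper) blast
  then have "morse_index a \<ge> 4" by (simp add: numeral_eq_enat)
  then show ?thesis
    using lin neg ambient_coord_index_form_diagonal[OF assms] by blast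
qed

end
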